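(* Let $\varphi$ be a Finsler norm in $\mathbb{R}^{d}$. Then for every open set $U\subseteq\mathbb{R}^{d}$, $$\mathrm{Sub}_{\varphi}(U)\subseteq CCA_{\varphi}(U)\qquad\text{and}\qquad \mathrm{Super}_{\varphi}(U)\subseteq CCB_{\varphi}(U).$$
   Context: A Finsler norm in $\mathbb{R}^d$ is a convex function $\varphi:\mathbb{R}^d\to[0,+\infty)$ with $\varphi(\lambda x)=\lambda\varphi(x)$ for all $\lambda>0$ and $\varphi(x)>0$ for $x\ne0$ (no symmetry is assumed). Its dual norm is $\varphi^{*}(p)=\max\{\langle p,q\rangle : \varphi(q)\le1\}$, and $\partial\varphi^{*}$ is the subdifferential of $\varphi^{*}$ (so $\partial\varphi^*(0)=\{\varphi\le 1\}$). With $\mathcal{S}_d$ the symmetric $d\times d$ matrices, for $(p,X)\in\mathbb{R}^d\times\mathcal{S}_d$, $$G_{\varphi}^{*}(p,X)=\max\{\langle Xq,q\rangle: q\in\partial\varphi^{*}(p)\},\qquad G_{*}^{\varphi}(p,X)=\min\{\langle Xq,q\rangle: q\in\partial\varphi^{*}(p)\}.$$ $USC(U)$, $LSC(U)$ are the real-valued upper/lower semicontinuous functions on $U$. $V\subset\subset U$ means $\overline V$ is compact and $\overline V\subseteq U$. $\mathrm{Sub}_\varphi(U)$ is the set of $u\in USC(U)$ with $-G_\varphi^*(Du,D^2u)\le0$ in $U$ in the viscosity sense: whenever $x_0\in U$, $\eta$ is smooth near $x_0$ and $u-\eta$ has a local maximum at $x_0$, then $-G_\varphi^*(D\eta(x_0),D^2\eta(x_0))\le0$.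 $\mathrm{Super}_\varphi(U)$ is the set of $v\in LSC(U)$ with $-G^\varphi_*(Dv,D^2v)\ge0$ in $U$ in the viscosity sense: whenever $v-\eta$ ($\eta$ smooth near $x_0$) has a local minimum at $x_0\in U$, then $-G_*^\varphi(D\eta(x_0),D^2\eta(x_0))\ge0$. $CCA_\varphi(U)$ (comparison with cones from above) is the set of $u\in USC(U)$ such that for every (nonempty) open $V\subset\subset U$, every $z\in\mathbb{R}^d\setminus V$ and every $\lambda>0$, $\max_{x\in\overline V}\,(u(x)-\lambda\varphi(x-z))=\max_{x\in\partial V}\,(u(x)-\lambda\varphi(x-z))$. $CCB_\varphi(U)$ (comparison with cones from below) is the set of $v\in LSC(U)$ such that for all such $V,z,\lambda$, $\min_{x\in\overline V}\,(v(x)+\lambda\varphi(z-x))=\min_{x\in\partial V}\,(v(x)+\lambda\varphi(z-x))$. *)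

theory Defs
  imports "HOL-Analysis.Analysis"
begin

section \<open>Finsler norms, dual norms and the extremal second-order operators\<close>

definition finsler_norm :: "(real ^ 'n \<Rightarrow> real) \<Rightarrow> bool" where
  "finsler_norm \<phi> \<longleftrightarrow>
     convex_on UNIV \<phi> \<and>
     (\<forall>x. 0 \<le> \<phi> x) \<and>
     (\<forall>l>0. \<forall>x. \<phi> (l *\<^sub>R x) = l * \<phi> x) \<and>
     (\<forall>x. x \<noteq> 0 \<longrightarrow> 0 < \<phi> x)"

text \<open>The suprema and infima of this section are a maximum or minimum whenever \<open>\<phi>\<close> is a
  Finsler norm; see \<open>dual_norm_attained\<close>, \<open>G_upper_attained\<close> and \<open>G_lower_attained\<close>.\<close>

definition dual_norm :: "(real ^ 'n \<Rightarrow> real) \<Rightarrow> real ^ 'n \<Rightarrow> real" where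
  "dual_norm \<phi> p = (SUP q\<in>{q. \<phi> q \<le> 1}. p \<bullet> q)"

definition subdifferential :: "(real ^ 'n \<Rightarrow> real) \<Rightarrow> real ^ 'n \<Rightarrow> (real ^ 'n) set" where
  "subdifferential f p = {q. \<forall>r. f p + q \<bullet> (r - p) \<le> f r}"

definition G_upper :: "(real ^ 'n \<Rightarrow> real) \<Rightarrow> real ^ 'n \<Rightarrow> real ^ 'n ^ 'n \<Rightarrow> real" where
  "G_upper \<phi> p X = (SUP q\<in>subdifferential (dual_norm \<phi>) p. (X *v q) \<bullet> q)"

definition G_lower :: "(real ^ 'n \<Rightarrow> real) \<Rightarrow> real ^ 'n \<Rightarrow> real ^ 'n ^ 'n \<Rightarrow> real" where
  "G_lower \<phi> p X = (INF q\<in>subdifferential (dual_norm \<phi>) p. (X *v q) \<bullet> q)"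


section \<open>Semicontinuity\<close>

text \<open>Functions on \<open>U\<close> are represented by total functions; no condition below depends on
  values outside \<open>U\<close>, provided \<open>U\<close> is open.\<close>

definition USC :: "(real ^ 'n) set \<Rightarrow> (real ^ 'n \<Rightarrow> real) set" where
  "USC U = {u. \<forall>x\<in>U. \<forall>a. u x < a \<longrightarrow> eventually (\<lambda>y. u y < a) (at x within U)}"

definition LSC :: "(real ^ 'n) set \<Rightarrow> (real ^ 'n \<Rightarrow> real) set" where
  "LSC U = {v. \<forall>x\<in>U. \<forall>a. a < v x \<longrightarrow> eventually (\<lambda>y. a < v y) (at x within U)}"


section \<open>Smooth functions, gradient and Hessian\<close>

text \<open>On an open set \<open>S\<close>, \<open>Ck_on k S f\<close> says that \<open>f\<close> is of class \<open>C\<^sup>k\<close>.\<close>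

primrec Ck_on :: "nat \<Rightarrow> (real ^ 'n) set \<Rightarrow> (real ^ 'n \<Rightarrow> real) \<Rightarrow> bool" where
  "Ck_on 0 S f \<longleftrightarrow> continuous_on S f"
| "Ck_on (Suc k) S f \<longleftrightarrow>
     (\<forall>x\<in>S. f differentiable (at x)) \<and>
     (\<forall>e. Ck_on k S (\<lambda>x. frechet_derivative f (at x) e))"

definition smooth_near :: "(real ^ 'n \<Rightarrow> real) \<Rightarrow> real ^ 'n \<Rightarrow> bool" where
  "smooth_near f x \<longleftrightarrow> (\<exists>S. open S \<and> x \<in> S \<and> (\<forall>k. Ck_on k S f))"

definition gradient :: "(real ^ 'n \<Rightarrow> real) \<Rightarrow> real ^ 'n \<Rightarrow> real ^ 'n" where
  "gradient f x = (\<chi> i. frechet_derivative f (at x) (axis i 1))"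

definition hessian :: "(real ^ 'n \<Rightarrow> real) \<Rightarrow> real ^ 'n \<Rightarrow> real ^ 'n ^ 'n" where
  "hessian f x = matrix (frechet_derivative (gradient f) (at x))"


section \<open>Viscosity sub- and supersolutions\<close>

definition local_max_at :: "(real ^ 'n \<Rightarrow> real) \<Rightarrow> real ^ 'n \<Rightarrow> bool" where
  "local_max_at f x \<longleftrightarrow> eventually (\<lambda>y. f y \<le> f x) (nhds x)"

definition local_min_at :: "(real ^ 'n \<Rightarrow> real) \<Rightarrow> real ^ 'n \<Rightarrow> bool" where
  "local_min_at f x \<longleftrightarrow> eventually (\<lambda>y. f x \<le> f y) (nhds x)"

definition Sub :: "(real ^ 'n \<Rightarrow> real) \<Rightarrow> (real ^ 'n) set \<Rightarrow> (real ^ 'n \<Rightarrow> real) set" where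
  "Sub \<phi> U = {u \<in> USC U.
     \<forall>x\<in>U. \<forall>\<eta>. smooth_near \<eta> x \<and> local_max_at (\<lambda>y. u y - \<eta> y) x \<longrightarrow>
       - G_upper \<phi> (gradient \<eta> x) (hessian \<eta> x) \<le> 0}"

definition Super :: "(real ^ 'n \<Rightarrow> real) \<Rightarrow> (real ^ 'n) set \<Rightarrow> (real ^ 'n \<Rightarrow> real) set" where
  "Super \<phi> U = {v \<in> LSC U.
     \<forall>x\<in>U. \<forall>\<eta>. smooth_near \<eta> x \<and> local_min_at (\<lambda>y. v y - \<eta> y) x \<longrightarrow>
       - G_lower \<phi> (gradient \<eta> x) (hessian \<eta> x) \<ge> 0}"


section \<open>Comparison with cones\<close>

definition compactly_inside :: "(real ^ 'n) set \<Rightarrow> (real ^ 'n) set \<Rightarrow> bool" where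
  "compactly_inside V U \<longleftrightarrow> compact (closure V) \<and> closure V \<subseteq> U"

text \<open>The suprema and infima below are attained: \<open>u\<close> is upper semicontinuous (\<open>v\<close> is lower
  semicontinuous), and \<open>closure V\<close> and \<open>frontier V\<close> are compact and nonempty; see
  \<open>cone_max_attained\<close>, \<open>cone_min_attained\<close> and \<open>compactly_inside_frontier\<close>.\<close>

definition CCA :: "(real ^ 'n \<Rightarrow> real) \<Rightarrow> (real ^ 'n) set \<Rightarrow> (real ^ 'n \<Rightarrow> real) set" where
  "CCA \<phi> U = {u \<in> USC U.
     \<forall>V z l. open V \<and> V \<noteq> {} \<and> compactly_inside V U \<and> z \<notin> V \<and> l > 0 \<longrightarrow>
       (SUP x\<in>closure V. u x - l * \<phi> (x - z)) = (SUP x\<in>frontier V. u x - l * \<phi> (x - z))}"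

definition CCB :: "(real ^ 'n \<Rightarrow> real) \<Rightarrow> (real ^ 'n) set \<Rightarrow> (real ^ 'n \<Rightarrow> real) set" where
  "CCB \<phi> U = {v \<in> LSC U.
     \<forall>V z l. open V \<and> V \<noteq> {} \<and> compactly_inside V U \<and> z \<notin> V \<and> l > 0 \<longrightarrow>
       (INF x\<in>closure V. v x + l * \<phi> (z - x)) = (INF x\<in>frontier V. v x + l * \<phi> (z - x))}"


section \<open>Attainment of the extrema\<close>

lemma finsler_norm_continuous:
  assumes "finsler_norm \<phi>" shows "continuous_on S \<phi>"
  using assms convex_on_continuous[of UNIV \<phi>] continuous_on_subset
  unfolding finsler_norm_def by blast

lemma finsler_norm_zero:
  assumes "finsler_norm \<phi>" shows "\<phi> 0 = 0"
proof -
  have "\<phi> ((2::real) *\<^sub>R 0) = 2 * \<phi> 0"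
    using assms unfolding finsler_norm_def by (metis zero_less_numeral)
  then show ?thesis by simp
qed

lemma finsler_norm_coercive:
  assumes f: "finsler_norm (\<phi> :: real ^ 'n \<Rightarrow> real)"
  obtains c where "c > 0" "\<And>x. c * norm x \<le> \<phi> x"
proof -
  have ne: "sphere (0::real^'n) 1 \<noteq> {}" by simp
  obtain y where y: "y \<in> sphere (0::real^'n) 1" "\<And>x. x \<in> sphere 0 1 \<Longrightarrow> \<phi> y \<le> \<phi> x"
    using continuous_attains_inf[OF compact_sphere ne finsler_norm_continuous[OF f]] by blast
  have "y \<noteq> 0" using y(1) by auto
  then have pos: "\<phi> y > 0" using f unfolding finsler_norm_def by blast
  have "\<phi> y * norm x \<le> \<phi> x" for x
  proof (cases "x = 0")
    case True
    then show ?thesis using finsler_norm_zero[OF f] by simp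
  next
    case False
    have "\<phi> y \<le> \<phi> (x /\<^sub>R norm x)" using False by (intro y(2)) simp
    also have "\<dots> = inverse (norm x) * \<phi> x"
      using f False unfolding finsler_norm_def by simp
    finally show ?thesis using False by (simp add: field_simps)
  qed
  with pos show ?thesis using that by blast
qed

lemma finsler_ball_compact:
  assumes f: "finsler_norm (\<phi> :: real ^ 'n \<Rightarrow> real)"
  shows "compact {q. \<phi> q \<le> 1}"
proof -
  obtain c where c: "c > 0" "\<And>x. c * norm x \<le> \<phi> x" using finsler_norm_coercive[OF f] by blast
  have "norm q \<le> 1 / c" if "\<phi> q \<le> 1" for q
    using c(2)[of q] that c(1) by (simp add: field_simps)
  then have "bounded {q. \<phi> q \<le> 1}" by (intro boundedI) auto
  moreover have "closed {q. \<phi> q \<le> 1}"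
    using finsler_norm_continuous[OF f, of UNIV]
    by (intro closed_Collect_le) auto
  ultimately show ?thesis by (simp add: compact_eq_bounded_closed)
qed

lemma dual_norm_attained:
  assumes f: "finsler_norm \<phi>"
  shows "\<exists>q. \<phi> q \<le> 1 \<and> dual_norm \<phi> p = p \<bullet> q \<and> (\<forall>r. \<phi> r \<le> 1 \<longrightarrow> p \<bullet> r \<le> p \<bullet> q)"
proof -
  have ne: "{q. \<phi> q \<le> 1} \<noteq> {}" using finsler_norm_zero[OF f] by (auto intro: exI[of _ 0])
  obtain q where q: "\<phi> q \<le> 1" "\<And>r. \<phi> r \<le> 1 \<Longrightarrow> p \<bullet> r \<le> p \<bullet> q"
    using continuous_attains_sup[OF finsler_ball_compact[OF f] ne
        continuous_on_inner[OF continuous_on_const continuous_on_id], of p] by auto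
  have "dual_norm \<phi> p = p \<bullet> q"
    unfolding dual_norm_def by (rule cSup_eq_maximum) (use q in auto)
  with q show ?thesis by blast
qed

lemma dual_norm_ge:
  assumes "finsler_norm \<phi>" "\<phi> q \<le> 1" shows "p \<bullet> q \<le> dual_norm \<phi> p"
  using dual_norm_attained[OF assms(1), of p] assms(2) by auto

lemma subdifferential_dual_norm_bound:
  assumes f: "finsler_norm \<phi>" and b: "\<And>s. \<phi> s \<le> 1 \<Longrightarrow> norm s \<le> b"
    and q: "q \<in> subdifferential (dual_norm \<phi>) p"
  shows "norm q \<le> b"
proof -
  obtain s where s: "\<phi> s \<le> 1" "dual_norm \<phi> (p + q) = (p + q) \<bullet> s"
    using dual_norm_attained[OF f] by blast
  have "dual_norm \<phi> p + q \<bullet> q \<le> dual_norm \<phi> (p + q)"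
    using q unfolding subdifferential_def by (auto dest: spec[of _ "p + q"])
  also have "\<dots> = p \<bullet> s + q \<bullet> s" using s by (simp add: inner_add_left)
  also have "\<dots> \<le> dual_norm \<phi> p + norm q * norm s"
    by (intro add_mono dual_norm_ge f s norm_cauchy_schwarz)
  finally have "norm q * norm q \<le> norm q * norm s"
    by (simp add: power2_norm_eq_inner[symmetric] power2_eq_square)
  then have "norm q \<le> norm s"
    by (cases "q = 0") auto
  also have "\<dots> \<le> b" using b s by blast
  finally show ?thesis .
qed

lemma subdifferential_dual_norm_compact:
  assumes f: "finsler_norm \<phi>" shows "compact (subdifferential (dual_norm \<phi>) p)"
proof -
  have "bounded (subdifferential (dual_norm \<phi>) p)"
  proof -
    obtain b where "\<And>s. \<phi> s \<le> 1 \<Longrightarrow> norm s \<le> b"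
      using compact_imp_bounded[OF finsler_ball_compact[OF f]] unfolding bounded_iff by blast
    then show ?thesis
      using subdifferential_dual_norm_bound[OF f] by (intro boundedI) blast
  qed
  moreover have "closed (subdifferential (dual_norm \<phi>) p)"
    unfolding subdifferential_def
    by (intro closed_Collect_all closed_Collect_le continuous_intros)
  ultimately show ?thesis by (simp add: compact_eq_bounded_closed)
qed

lemma subdifferential_dual_norm_nonempty:
  assumes f: "finsler_norm \<phi>" shows "subdifferential (dual_norm \<phi>) p \<noteq> {}"
proof -
  obtain q where q: "\<phi> q \<le> 1" "dual_norm \<phi> p = p \<bullet> q"
    using dual_norm_attained[OF f] by blast
  have "dual_norm \<phi> p + q \<bullet> (r - p) \<le> dual_norm \<phi> r" for r
    using dual_norm_ge[OF f q(1), of r] q(2) by (simp add: inner_diff_right inner_commute)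
  then have "q \<in> subdifferential (dual_norm \<phi>) p" by (simp add: subdifferential_def)
  then show ?thesis by blast
qed

lemma quadratic_form_continuous:
  "continuous_on S (\<lambda>q. ((X :: real ^ 'n ^ 'n) *v q) \<bullet> q)"
  by (intro continuous_on_inner continuous_on_id
      linear_continuous_on matrix_vector_mul_bounded_linear)

lemma G_upper_attained:
  assumes f: "finsler_norm \<phi>"
  shows "\<exists>q\<in>subdifferential (dual_norm \<phi>) p. G_upper \<phi> p X = (X *v q) \<bullet> q \<and>
           (\<forall>r\<in>subdifferential (dual_norm \<phi>) p. (X *v r) \<bullet> r \<le> (X *v q) \<bullet> q)"
proof -
  obtain q where q: "q \<in> subdifferential (dual_norm \<phi>) p"
      "\<forall>r\<in>subdifferential (dual_norm \<phi>) p. (X *v r) \<bullet> r \<le> (X *v q) \<bullet> q"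
    using continuous_attains_sup[OF subdifferential_dual_norm_compact[OF f]
        subdifferential_dual_norm_nonempty[OF f] quadratic_form_continuous] by blast
  have "G_upper \<phi> p X = (X *v q) \<bullet> q"
    unfolding G_upper_def by (rule cSup_eq_maximum) (use q in auto)
  with q show ?thesis by blast
qed

lemma G_lower_attained:
  assumes f: "finsler_norm \<phi>"
  shows "\<exists>q\<in>subdifferential (dual_norm \<phi>) p. G_lower \<phi> p X = (X *v q) \<bullet> q \<and>
           (\<forall>r\<in>subdifferential (dual_norm \<phi>) p. (X *v q) \<bullet> q \<le> (X *v r) \<bullet> r)"
proof -
  obtain q where q: "q \<in> subdifferential (dual_norm \<phi>) p"
      "\<forall>r\<in>subdifferential (dual_norm \<phi>) p. (X *v q) \<bullet> q \<le> (X *v r) \<bullet> r"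
    using continuous_attains_inf[OF subdifferential_dual_norm_compact[OF f]
        subdifferential_dual_norm_nonempty[OF f] quadratic_form_continuous] by blast
  have "G_lower \<phi> p X = (X *v q) \<bullet> q"
    unfolding G_lower_def by (rule cInf_eq_minimum) (use q in auto)
  with q show ?thesis by blast
qed

lemma LSC_attains_inf:
  assumes v: "v \<in> LSC U" and K: "compact K" "K \<noteq> {}" "K \<subseteq> U"
    and g: "continuous_on U g"
  shows "\<exists>x\<in>K. (INF y\<in>K. v y + g y) = v x + g x \<and> (\<forall>y\<in>K. v x + g x \<le> v y + g y)"
proof -
  have op: "\<exists>T. open T \<and> x \<in> T \<and> (\<forall>y\<in>T \<inter> U. a < v y + g y)" if x: "x \<in> U" "a < v x + g x" for a x
  proof -
    define e where "e = (v x + g x - a) / 2"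
    have e: "e > 0" using x by (simp add: e_def)
    have "eventually (\<lambda>y. v x - e < v y) (at x within U)"
      using v x e unfolding LSC_def by auto
    moreover have "eventually (\<lambda>y. g x - e < g y) (at x within U)"
      using g x e unfolding continuous_on_def by (intro order_tendstoD(1)[of g "g x"]) auto
    ultimately have "eventually (\<lambda>y. a < v y + g y) (at x within U)"
      by eventually_elim (auto simp: e_def field_simps)
    then obtain T where "open T" "x \<in> T" "\<And>y. y \<in> T \<Longrightarrow> y \<noteq> x \<Longrightarrow> y \<in> U \<Longrightarrow> a < v y + g y"
      unfolding eventually_at_topological by blast
    then show ?thesis using x(2) by blast
  qed
  have "\<exists>x\<in>K. \<forall>y\<in>K. v x + g x \<le> v y + g y"
  proof (rule ccontr)
    assume "\<not> ?thesis"
    then have "\<forall>x\<in>K. \<exists>y\<in>K. v y + g y < v x + g x" by (meson not_le)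
    then obtain m where m: "\<And>x. x \<in> K \<Longrightarrow> m x \<in> K \<and> v (m x) + g (m x) < v x + g x" by metis
    have "\<forall>x\<in>K. \<exists>T. open T \<and> x \<in> T \<and> (\<forall>y\<in>T \<inter> U. v (m x) + g (m x) < v y + g y)"
      using m op K(3) by blast
    then obtain T where T: "\<And>x. x \<in> K \<Longrightarrow>
        open (T x) \<and> x \<in> T x \<and> (\<forall>y\<in>T x \<inter> U. v (m x) + g (m x) < v y + g y)" by metis
    obtain C where C: "C \<subseteq> K" "finite C" "K \<subseteq> (\<Union>c\<in>C. T c)"
      using compactE_image[OF K(1), of K T] T by blast
    have "C \<noteq> {}" using C K(2) by auto
    define h where "h = (\<lambda>c. v (m c) + g (m c))"
    obtain c where c: "c \<in> C" "\<forall>d\<in>C. h c \<le> h d"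
      using \<open>C \<noteq> {}\<close> C(2) Min_in[of "h ` C"] Min_le[of "h ` C"] by fastforce
    have "m c \<in> K" using m c C by blast
    then obtain d where d: "d \<in> C" "m c \<in> T d" using C by blast
    then have "h d < h c" using T[of d] C K(3) \<open>m c \<in> K\<close> unfolding h_def by blast
    then show False using c d by force
  qed
  then obtain x where x: "x \<in> K" "\<forall>y\<in>K. v x + g x \<le> v y + g y" by blast
  have "(INF y\<in>K. v y + g y) = v x + g x"
    by (rule cInf_eq_minimum) (use x in auto)
  with x show ?thesis by blast
qed

lemma finsler_cone_continuous:
  assumes f: "finsler_norm \<phi>"
  shows "continuous_on S (\<lambda>y. l * \<phi> (y - z))" "continuous_on S (\<lambda>y. l * \<phi> (z - y))"
proof -
  have "continuous_on S (\<phi> \<circ> (\<lambda>y. y - z))" "continuous_on S (\<phi> \<circ> (\<lambda>y. z - y))"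
    by (intro continuous_on_compose finsler_norm_continuous[OF f] continuous_intros)+
  then show "continuous_on S (\<lambda>y. l * \<phi> (y - z))" "continuous_on S (\<lambda>y. l * \<phi> (z - y))"
    unfolding comp_def by (auto intro: continuous_on_mult_left)
qed

lemma cone_min_attained:
  assumes "finsler_norm \<phi>" "v \<in> LSC U" "compact K" "K \<noteq> {}" "K \<subseteq> U"
  shows "\<exists>x\<in>K. (INF y\<in>K. v y + l * \<phi> (z - y)) = v x + l * \<phi> (z - x) \<and>
           (\<forall>y\<in>K. v x + l * \<phi> (z - x) \<le> v y + l * \<phi> (z - y))"
  by (rule LSC_attains_inf[OF assms(2-5) finsler_cone_continuous(2)[OF assms(1), of U l z]])

lemma cone_max_attained:
  assumes f: "finsler_norm \<phi>" and u: "u \<in> USC U" and K: "compact K" "K \<noteq> {}" "K \<subseteq> U"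
  shows "\<exists>x\<in>K. (SUP y\<in>K. u y - l * \<phi> (y - z)) = u x - l * \<phi> (x - z) \<and>
           (\<forall>y\<in>K. u y - l * \<phi> (y - z) \<le> u x - l * \<phi> (x - z))"
proof -
  have L: "(\<lambda>x. - u x) \<in> LSC U"
    unfolding LSC_def
  proof (clarify)
    fix x a assume "x \<in> U" "a < - u x"
    then have "u x < - a" by simp
    then have "eventually (\<lambda>y. u y < - a) (at x within U)"
      using u \<open>x \<in> U\<close> unfolding USC_def by blast
    then show "eventually (\<lambda>y. a < - u y) (at x within U)" by eventually_elim simp
  qed
  obtain x where x: "x \<in> K" "\<forall>y\<in>K. - u x + l * \<phi> (x - z) \<le> - u y + l * \<phi> (y - z)"
    using LSC_attains_inf[OF L K finsler_cone_continuous(1)[OF f, of U l z]] by auto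
  then have x': "\<forall>y\<in>K. u y - l * \<phi> (y - z) \<le> u x - l * \<phi> (x - z)" by (auto simp: algebra_simps)
  have "(SUP y\<in>K. u y - l * \<phi> (y - z)) = u x - l * \<phi> (x - z)"
    by (rule cSup_eq_maximum) (use x x' in auto)
  with x(1) x' show ?thesis by blast
qed

lemma compactly_inside_frontier:
  assumes "V \<noteq> {}" "compactly_inside V U"
  shows "compact (frontier V)" "frontier V \<noteq> {}" "frontier V \<subseteq> U"
proof -
  have b: "bounded V"
    using assms(2) bounded_subset[OF compact_imp_bounded closure_subset]
    unfolding compactly_inside_def by simp
  then show "compact (frontier V)" by (rule compact_frontier_bounded)
  have "V \<noteq> UNIV" using b not_bounded_UNIV by auto
  then show "frontier V \<noteq> {}" using assms(1) by (simp add: frontier_eq_empty)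
  show "frontier V \<subseteq> U"
    using assms(2) unfolding compactly_inside_def frontier_def by blast
qed

end

theory Submission
  imports Defs "HOL-Probability.Probability" "HOL-Real_Asymp.Real_Asymp"
begin

text \<open>Suppose a subsolution \<open>u\<close> violates comparison from above with the cone \<open>l * \<phi> (x - z)\<close> on \<open>V\<close>.
  Were \<open>\<phi>\<close> smooth off the origin, \<open>u\<close> would be touched from above, at a point of \<open>V\<close> away from
  \<open>z\<close>, by a vertical translate of the perturbed cone \<open>l * \<phi> - k * \<phi>\<^sup>2\<close> (vertex \<open>z\<close>, small \<open>k > 0\<close>).
  At \<open>p = D\<phi>(x)\<close> every
  \<open>q \<in> \<partial>\<phi>\<^sup>*(p)\<close> has \<open>\<langle>p, q\<rangle> = 1\<close> and \<open>\<langle>D\<^sup>2\<phi>(x) q, q\<rangle> = 0\<close>, because \<open>\<phi>\<close> is affine along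
  \<open>x + t q\<close>, \<open>t \<ge> 0\<close>; so the perturbation has \<open>\<langle>D\<^sup>2 q, q\<rangle> < 0\<close> for all these \<open>q\<close>, a contradiction.

  The real issue is that \<open>\<phi>\<close> is only convex. A regularization \<open>w\<close> of \<open>\<phi>\<close> is required whose
  Hessian is nearly degenerate in the directions \<open>\<partial>\<phi>\<^sup>*(Dw)\<close>, where \<open>\<phi>\<^sup>*\<close> still is the dual of the
  original norm (\<open>soft_cone_exists\<close>). With \<open>D\<close> the polar body \<open>{p. \<forall>q. \<langle>p, q\<rangle> \<le> \<phi> q}\<close>, it is

    \<open>w(x) = \<delta> ln \<integral>\<^sub>D exp ((\<langle>p, x\<rangle> - \<epsilon> |p|\<^sup>2 / 2) / \<delta>) dp\<close>,

  a smooth version of the Moreau envelope \<open>sup\<^sub>p\<^sub>\<in>\<^sub>D \<langle>p, x\<rangle> - \<epsilon> |p|\<^sup>2 / 2\<close> of \<open>\<phi>\<close>. Under the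
  associated Gibbs measure on \<open>D\<close>, the gradient \<open>m\<close> of \<open>w\<close> is the mean of \<open>p\<close>, and
  \<open>\<langle>D\<^sup>2w q, q\<rangle>\<close> is the variance of \<open>\<langle>p, q\<rangle>\<close> divided by \<open>\<delta>\<close>.

  For \<open>q \<in> \<partial>\<phi>\<^sup>*(m)\<close> the variable \<open>X = 1 - \<langle>p, q\<rangle>\<close> is nonnegative on \<open>D\<close>. Its mean \<open>1 - \<phi>\<^sup>*(m)\<close> is
  \<open>O(\<delta>)\<close>, since the optimality gap of the exponent has bounded moments
  (\<open>gibbs_exp_half_bound\<close>). The term \<open>\<epsilon> |p|\<^sup>2\<close> makes the Gibbs measure concentrate at scale
  \<open>(\<delta>/\<epsilon>)\<^bsup>1/2\<^esup>\<close>, so that fourth moments are \<open>O((\<delta>/\<epsilon>)\<^sup>2)\<close>. A nonnegative variable with so small a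
  mean and such a concentration has variance \<open>o(\<delta>)\<close> (\<open>variance_le_fourth_moment\<close>), which gives
  \<open>\<langle>D\<^sup>2w q, q\<rangle> \<rightarrow> 0\<close> (\<open>soft_norm_degenerate\<close>).

  Only second-order Taylor bounds of \<open>w\<close> are used: viscosity tests with quadratic polynomials are
  enough. Supersolutions reduce to subsolutions by \<open>u = - v\<close> and the reflected norm
  \<open>\<phi>(- x)\<close>.\<close>

section \<open>Quadratic test functions\<close>

lemma Ck_on_const: "Ck_on k UNIV (\<lambda>x::real^'n. c)"
proof (induction k arbitrary: c)
  case (Suc k)
  have "frechet_derivative (\<lambda>x::real^'n. c) (at x) = (\<lambda>_. 0)" for x
    by (rule frechet_derivative_at[symmetric]) simp
  then show ?case using Suc by simp
qed simp

lemma Ck_on_affine: "Ck_on k UNIV (\<lambda>x::real^'n. c + a \<bullet> x)"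
proof (cases k)
  case (Suc m)
  have d: "((\<lambda>x::real^'n. c + a \<bullet> x) has_derivative (\<lambda>h. a \<bullet> h)) (at x)" for x
    by (auto intro!: derivative_eq_intros)
  then have "frechet_derivative (\<lambda>x::real^'n. c + a \<bullet> x) (at x) = (\<lambda>h. a \<bullet> h)" for x
    using frechet_derivative_at by metis
  then show ?thesis using Suc d Ck_on_const by (auto simp: differentiable_def)
qed (auto intro!: continuous_intros)

definition quadratic :: "real \<Rightarrow> real^'n \<Rightarrow> (real^'n \<Rightarrow> real^'n) \<Rightarrow> real^'n \<Rightarrow> real^'n \<Rightarrow> real" where
  "quadratic c b S x0 x = c + b \<bullet> (x - x0) + (S (x - x0) \<bullet> (x - x0)) / 2"

context
  fixes S :: "real^'n \<Rightarrow> real^'n" and b x0 :: "real^'n" and c :: real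
  assumes S: "linear S" and sym: "\<And>v w. S v \<bullet> w = v \<bullet> S w"
begin

lemma quadratic_has_derivative:
  "(quadratic c b S x0 has_derivative (\<lambda>h. (b + S (x - x0)) \<bullet> h)) (at x)"
proof -
  have bl: "bounded_linear S" using S linear_conv_bounded_linear by blast
  have dS: "((\<lambda>x. S (x - x0)) has_derivative (\<lambda>h. S h)) (at x)"
    by (rule bounded_linear.has_derivative[OF bl]) (auto intro!: derivative_eq_intros)
  have eq: "(b + S (x - x0)) \<bullet> h = b \<bullet> h + (S (x - x0) \<bullet> h + S h \<bullet> (x - x0)) / 2" for h
    using sym[of "x - x0" h] inner_commute[of "x - x0" "S h"] by (simp add: inner_add_left)
  show ?thesis unfolding quadratic_def[abs_def] eq
    by (rule derivative_eq_intros dS refl | simp)+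
qed

lemma quadratic_frechet: "frechet_derivative (quadratic c b S x0) (at x) = (\<lambda>h. (b + S (x - x0)) \<bullet> h)"
  using frechet_derivative_at[OF quadratic_has_derivative] by simp

lemma quadratic_smooth: "smooth_near (quadratic c b S x0) x"
proof -
  have sy: "e \<bullet> S x = x \<bullet> S e" for e x
    using sym[of x e] inner_commute[of "S x" e] by simp
  have eq: "(\<lambda>x. (b + S (x - x0)) \<bullet> e) = (\<lambda>x. (b \<bullet> e - x0 \<bullet> S e) + S e \<bullet> x)" for e
    using S by (simp add: fun_eq_iff linear_diff inner_add_left inner_diff_left sym sy[of e])
  have diff: "quadratic c b S x0 differentiable (at x)" for x
    using quadratic_has_derivative differentiable_def by blast
  have "Ck_on k UNIV (quadratic c b S x0)" for k
  proof (cases k)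
    case 0
    then show ?thesis
      by (auto intro: continuous_at_imp_continuous_on differentiable_imp_continuous_within diff)
  next
    case (Suc m)
    have "Ck_on m UNIV (\<lambda>x. frechet_derivative (quadratic c b S x0) (at x) e)" for e
      unfolding quadratic_frechet eq by (rule Ck_on_affine)
    then show ?thesis unfolding Suc Ck_on.simps using diff by blast
  qed
  then show ?thesis unfolding smooth_near_def by blast
qed

lemma quadratic_gradient: "gradient (quadratic c b S x0) x = b + S (x - x0)"
  by (simp add: gradient_def quadratic_frechet vec_eq_iff inner_axis)

lemma quadratic_hessian: "hessian (quadratic c b S x0) x *v h = S h"
proof -
  have bl: "bounded_linear S" using S linear_conv_bounded_linear by blast
  have dS: "((\<lambda>x. S (x - x0)) has_derivative S) (at x)"
    by (rule bounded_linear.has_derivative[OF bl]) (auto intro!: derivative_eq_intros)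
  have "gradient (quadratic c b S x0) = (\<lambda>x. b + S (x - x0))"
    using quadratic_gradient by blast
  moreover have "((\<lambda>x. b + S (x - x0)) has_derivative S) (at x)"
    using has_derivative_add[OF has_derivative_const[of b] dS] by simp
  ultimately have "frechet_derivative (gradient (quadratic c b S x0)) (at x) = S"
    using frechet_derivative_at by metis
  then show ?thesis by (simp add: hessian_def matrix_works S linear_matrix_vector_mul_eq)
qed

end

text \<open>The viscosity inequality restricted to quadratic test functions and phrased through a self-adjoint
  map and a single direction \<open>q\<close>. In this form it is common to subsolutions and to reflected
  supersolutions.\<close>
definition quadratic_subsolution :: "(real^'n \<Rightarrow> real) \<Rightarrow> (real^'n) set \<Rightarrow> (real^'n \<Rightarrow> real) \<Rightarrow> bool" where
  "quadratic_subsolution \<phi> U u \<longleftrightarrow> (\<forall>x\<in>U. \<forall>b S. 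
      linear S \<and> (\<forall>v w. S v \<bullet> w = v \<bullet> S w) \<and>
      (\<forall>\<^sub>F y in nhds x. u y \<le> quadratic (u x) b S x y) \<longrightarrow>
      (\<exists>q\<in>subdifferential (dual_norm \<phi>) b. 0 \<le> S q \<bullet> q))"

lemma Sub_quadratic:
  fixes \<phi> :: "real^'n \<Rightarrow> real"
  assumes f: "finsler_norm \<phi>" and u: "u \<in> Sub \<phi> U"
  shows "quadratic_subsolution \<phi> U u"
  unfolding quadratic_subsolution_def
proof (intro ballI allI impI, elim conjE)
  fix x b and S :: "real^'n \<Rightarrow> real^'n"
  assume x: "x \<in> U" and S: "linear S" and sym: "\<forall>v w. S v \<bullet> w = v \<bullet> S w"
    and ev: "\<forall>\<^sub>F y in nhds x. u y \<le> quadratic (u x) b S x y"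
  let ?eta = "quadratic (u x) b S x"
  have e0: "?eta x = u x" using S by (simp add: quadratic_def linear_0)
  have lm: "local_max_at (\<lambda>y. u y - ?eta y) x"
    unfolding local_max_at_def using ev by eventually_elim (simp add: e0)
  have sy: "S v \<bullet> w = v \<bullet> S w" for v w using sym by blast
  have "- G_upper \<phi> (gradient ?eta x) (hessian ?eta x) \<le> 0"
    using u x lm quadratic_smooth[OF S sy] unfolding Sub_def by blast
  then have "0 \<le> G_upper \<phi> b (hessian ?eta x)"
    using S by (simp add: quadratic_gradient[OF S sy] linear_0)
  then show "\<exists>q\<in>subdifferential (dual_norm \<phi>) b. 0 \<le> S q \<bullet> q"
    using G_upper_attained[OF f, of b "hessian ?eta x"]
    by (auto simp: quadratic_hessian[OF S sy])
qed

lemma finsler_norm_reflect: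
  assumes "finsler_norm \<phi>" shows "finsler_norm (\<lambda>x. \<phi> (- x))"
proof -
  have "convex_on UNIV (\<lambda>x. \<phi> (- x))"
  proof (rule convex_onI)
    fix t x y assume t: "0 < t" "t < (1::real)"
    have "\<phi> (- ((1 - t) *\<^sub>R x + t *\<^sub>R y)) = \<phi> ((1 - t) *\<^sub>R (- x) + t *\<^sub>R (- y))"
      by (simp add: algebra_simps)
    also have "\<dots> \<le> (1 - t) * \<phi> (- x) + t * \<phi> (- y)"
      using assms t unfolding finsler_norm_def by (intro convex_onD[of UNIV]) auto
    finally show "\<phi> (- ((1 - t) *\<^sub>R x + t *\<^sub>R y)) \<le> (1 - t) * \<phi> (- x) + t * \<phi> (- y)" .
  qed simp
  then show ?thesis using assms unfolding finsler_norm_def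
    by (metis scaleR_minus_right neg_equal_0_iff_equal)
qed

lemma dual_norm_reflect:
  "dual_norm (\<lambda>x. \<phi> (- x)) p = dual_norm \<phi> (- p)"
proof -
  have "{q. \<phi> (- q) \<le> 1} = uminus ` {q. \<phi> q \<le> 1}" by (auto intro!: image_eqI[of _ uminus])
  then show ?thesis unfolding dual_norm_def by (simp add: image_comp o_def)
qed

lemma subdifferential_dual_reflect:
  fixes \<phi> :: "real^'n \<Rightarrow> real"
  shows "q \<in> subdifferential (dual_norm (\<lambda>x. \<phi> (- x))) p \<longleftrightarrow> - q \<in> subdifferential (dual_norm \<phi>) (- p)"
proof -
  have "(\<forall>r. P (- r)) \<longleftrightarrow> (\<forall>r. P r)" for P :: "real^'n \<Rightarrow> bool" by (metis minus_minus)
  from this[of "\<lambda>r. dual_norm \<phi> (- p) + (- q) \<bullet> (r - (- p)) \<le> dual_norm \<phi> r"]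
  show ?thesis unfolding subdifferential_def dual_norm_reflect
    by (simp add: inner_diff_right algebra_simps)
qed

text \<open>Negation turns a minimum over \<open>\<partial>\<phi>\<^sup>*(- b)\<close> into a maximum over the reflected set
  \<open>- \<partial>\<phi>\<^sup>*(- b)\<close>, which is the subdifferential for the reflected norm; quadratic forms are even.\<close>
lemma Super_quadratic:
  fixes \<phi> :: "real^'n \<Rightarrow> real"
  assumes f: "finsler_norm \<phi>" and v: "v \<in> Super \<phi> U"
  shows "quadratic_subsolution (\<lambda>x. \<phi> (- x)) U (\<lambda>x. - v x)"
  unfolding quadratic_subsolution_def
proof (intro ballI allI impI, elim conjE)
  fix x b and S :: "real^'n \<Rightarrow> real^'n"
  assume x: "x \<in> U" and S: "linear S" and sym: "\<forall>v w. S v \<bullet> w = v \<bullet> S w"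
    and ev: "\<forall>\<^sub>F y in nhds x. - v y \<le> quadratic (- v x) b S x y"
  define S' where "S' h = - S h" for h
  have S': "linear S'" unfolding S'_def using S linear_compose_neg by blast
  have sy: "S' v \<bullet> w = v \<bullet> S' w" for v w using sym unfolding S'_def by simp
  let ?eta = "quadratic (v x) (- b) S' x"
  have e0: "?eta x = v x" using S' by (simp add: quadratic_def linear_0)
  have lm: "local_min_at (\<lambda>y. v y - ?eta y) x"
    unfolding local_min_at_def using ev
    by eventually_elim (simp add: e0, simp add: quadratic_def S'_def)
  have "- G_lower \<phi> (gradient ?eta x) (hessian ?eta x) \<ge> 0"
    using v x lm quadratic_smooth[OF S' sy] unfolding Super_def by blast
  then have "G_lower \<phi> (- b) (hessian ?eta x) \<le> 0"
    using S' by (simp add: quadratic_gradient[OF S' sy] linear_0)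
  then obtain q where q: "q\<in>subdifferential (dual_norm \<phi>) (- b)" "S' q \<bullet> q \<le> 0"
    using G_lower_attained[OF f, of "- b" "hessian ?eta x"]
    by (auto simp: quadratic_hessian[OF S' sy])
  have "- q \<in> subdifferential (dual_norm (\<lambda>x. \<phi> (- x))) b"
    using q(1) by (simp add: subdifferential_dual_reflect)
  moreover have "0 \<le> S (- q) \<bullet> (- q)" using q(2) S by (simp add: S'_def linear_neg)
  ultimately show "\<exists>q\<in>subdifferential (dual_norm (\<lambda>x. \<phi> (- x))) b. 0 \<le> S q \<bullet> q" by blast
qed

section \<open>The polar body\<close>

definition polar :: "(real^'n \<Rightarrow> real) \<Rightarrow> (real^'n) set" where
  "polar \<phi> = {p. \<forall>q. p \<bullet> q \<le> \<phi> q}"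

lemma finsler_norm_scale:
  assumes "finsler_norm \<phi>" "0 \<le> l" shows "\<phi> (l *\<^sub>R x) = l * \<phi> x"
  using assms finsler_norm_zero[OF assms(1)] unfolding finsler_norm_def by (cases "l = 0") auto

lemma finsler_norm_nonneg: "finsler_norm \<phi> \<Longrightarrow> 0 \<le> \<phi> x"
  unfolding finsler_norm_def by blast

lemma convex_polar: "convex (polar \<phi>)"
proof -
  have "polar \<phi> = (\<Inter>q. {p. q \<bullet> p \<le> \<phi> q})" by (auto simp: polar_def inner_commute)
  then show ?thesis by (simp add: convex_INT convex_halfspace_le)
qed

lemma compact_polar:
  fixes \<phi> :: "real^'n \<Rightarrow> real"
  assumes "finsler_norm \<phi>" shows "compact (polar \<phi>)"
proof -
  obtain b where b: "\<And>q. norm q \<le> 1 \<Longrightarrow> \<phi> q \<le> b"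
  proof -
    have "compact (\<phi> ` cball 0 1)"
      by (intro compact_continuous_image finsler_norm_continuous[OF assms]) simp
    then have "bdd_above (\<phi> ` cball 0 1)" by (intro bounded_imp_bdd_above compact_imp_bounded)
    then obtain M where "\<forall>q\<in>cball 0 1. \<phi> q \<le> M" by (auto simp: bdd_above_def)
    then show thesis using that[of M] by simp
  qed
  have "norm p \<le> b" if p: "p \<in> polar \<phi>" for p
  proof (cases "p = 0")
    case True
    then show ?thesis using b[of 0] finsler_norm_nonneg[OF assms, of 0] by simp
  next
    case False
    have "norm p = p \<bullet> (p /\<^sub>R norm p)" using False
      by (simp add: power2_norm_eq_inner[symmetric] power2_eq_square)
    also have "\<dots> \<le> \<phi> (p /\<^sub>R norm p)" using p unfolding polar_def by blast
    also have "\<dots> \<le> b" using False by (intro b) simp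
    finally show ?thesis .
  qed
  then have "bounded (polar \<phi>)" by (auto intro: boundedI)
  moreover have "closed (polar \<phi>)"
    unfolding polar_def by (intro closed_Collect_all closed_Collect_le continuous_intros)
  ultimately show ?thesis by (simp add: compact_eq_bounded_closed)
qed

lemma interior_polar:
  fixes \<phi> :: "real^'n \<Rightarrow> real"
  assumes "finsler_norm \<phi>" shows "interior (polar \<phi>) \<noteq> {}"
proof -
  obtain c where c: "c > 0" "\<And>x. c * norm x \<le> \<phi> x" using finsler_norm_coercive[OF assms] by blast
  have "ball 0 c \<subseteq> polar \<phi>"
  proof
    fix p :: "real^'n" assume "p \<in> ball 0 c"
    then have "p \<bullet> q \<le> c * norm q" for q
      using norm_cauchy_schwarz[of p q] mult_right_mono[of "norm p" c "norm q"] by force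
    then show "p \<in> polar \<phi>" unfolding polar_def using c(2) order_trans by blast
  qed
  then have "0 \<in> interior (polar \<phi>)" using c(1) by (auto simp: mem_interior)
  then show ?thesis by blast
qed

text \<open>For \<open>x \<noteq> 0\<close> by Hahn--Banach: the open sublevel set \<open>{\<phi> < \<phi> x}\<close> is convex and misses \<open>x\<close>; a separating
  functional, normalized to the value \<open>\<phi> x\<close> at \<open>x\<close>, lies in the polar body by homogeneity.\<close>
lemma polar_supports:
  fixes \<phi> :: "real^'n \<Rightarrow> real"
  assumes f: "finsler_norm \<phi>" shows "\<exists>p\<in>polar \<phi>. p \<bullet> x = \<phi> x"
proof (cases "x = 0")
  case True
  have "0 \<in> polar \<phi>" using finsler_norm_nonneg[OF f] by (simp add: polar_def)
  then show ?thesis using True finsler_norm_zero[OF f] by auto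
next
  case False
  define s where "s = \<phi> x"
  have s: "s > 0" using f False unfolding finsler_norm_def s_def by blast
  have conv: "convex {q. \<phi> q < s}"
  proof (rule convexI, clarify)
    fix u v a b assume *: "\<phi> u < s" "\<phi> v < s" and ab: "0 \<le> a" "0 \<le> b" "a + b = (1::real)"
    have "\<phi> (a *\<^sub>R u + b *\<^sub>R v) \<le> a * \<phi> u + b * \<phi> v"
      using f ab unfolding finsler_norm_def convex_on_def by auto
    also have "\<dots> < s" using * ab convex_bound_lt by blast
    finally show "\<phi> (a *\<^sub>R u + b *\<^sub>R v) < s" .
  qed
  have z: "0 \<in> {q. \<phi> q < s}" using s finsler_norm_zero[OF f] by simp
  obtain a b where ab: "a \<noteq> 0" "\<And>q. \<phi> q < s \<Longrightarrow> a \<bullet> q \<le> b" "b \<le> a \<bullet> x"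
    using separating_hyperplane_sets[OF conv convex_singleton[of x]] z
    by (force simp: s_def)
  have ax: "a \<bullet> x > 0"
  proof -
    define t where "t = s / (2 * (\<phi> a + 1))"
    have t: "t > 0" using s finsler_norm_nonneg[OF f, of a] by (simp add: t_def)
    have "\<phi> (t *\<^sub>R a) = t * \<phi> a" using t finsler_norm_scale[OF f] by simp
    also have "\<dots> < s"
    proof -
      have "s * \<phi> a < s * (2 * (\<phi> a + 1))"
        using s finsler_norm_nonneg[OF f, of a] by (intro mult_strict_left_mono) auto
      then show ?thesis using finsler_norm_nonneg[OF f, of a] by (simp add: t_def field_simps)
    qed
    finally have "a \<bullet> (t *\<^sub>R a) \<le> b" using ab(2) by blast
    moreover have "a \<bullet> (t *\<^sub>R a) > 0" using t ab(1) by simp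
    ultimately show ?thesis using ab(3) by linarith
  qed
  define p where "p = (s / (a \<bullet> x)) *\<^sub>R a"
  have "p \<bullet> q \<le> \<phi> q" for q
  proof (rule field_le_epsilon)
    fix e :: real assume e: "e > 0"
    define g where "g = \<phi> q + e"
    have g: "g > 0" "\<phi> q < g" using e finsler_norm_nonneg[OF f, of q] by (auto simp: g_def)
    have "\<phi> ((s / g) *\<^sub>R q) = (s / g) * \<phi> q" using finsler_norm_scale[OF f] s g by simp
    also have "\<dots> < s" using s g by (simp add: field_simps)
    finally have "a \<bullet> ((s / g) *\<^sub>R q) \<le> a \<bullet> x" using ab(2,3) order_trans by blast
    then have "s * (a \<bullet> q) \<le> g * (a \<bullet> x)" using g by (simp add: field_simps)
    then have "p \<bullet> q \<le> g" using ax by (simp add: p_def field_simps)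
    then show "p \<bullet> q \<le> \<phi> q + e" by (simp add: g_def)
  qed
  moreover have "p \<bullet> x = \<phi> x" using ax by (simp add: p_def s_def)
  ultimately show ?thesis unfolding polar_def by blast
qed

lemma dual_norm_scale:
  fixes \<phi> :: "real^'n \<Rightarrow> real"
  assumes f: "finsler_norm \<phi>" and a: "0 \<le> a"
  shows "dual_norm \<phi> (a *\<^sub>R p) = a * dual_norm \<phi> p"
proof (rule antisym)
  obtain q where q: "\<phi> q \<le> 1" "dual_norm \<phi> (a *\<^sub>R p) = (a *\<^sub>R p) \<bullet> q"
    using dual_norm_attained[OF f] by blast
  show "dual_norm \<phi> (a *\<^sub>R p) \<le> a * dual_norm \<phi> p"
    using dual_norm_ge[OF f q(1), of p] a q(2) by (simp add: mult_left_mono)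
  obtain q where q: "\<phi> q \<le> 1" "dual_norm \<phi> p = p \<bullet> q"
    using dual_norm_attained[OF f] by blast
  show "a * dual_norm \<phi> p \<le> dual_norm \<phi> (a *\<^sub>R p)"
    using dual_norm_ge[OF f q(1), of "a *\<^sub>R p"] q(2) by simp
qed

text \<open>Euler's identity: comparing the subgradient inequality at \<open>0\<close> and at \<open>2 p\<close> determines \<open>\<langle>q, p\<rangle>\<close>,
  as the dual norm is positively homogeneous.\<close>
lemma subdifferential_dual_norm_iff:
  fixes \<phi> :: "real^'n \<Rightarrow> real"
  assumes f: "finsler_norm \<phi>"
  shows "q \<in> subdifferential (dual_norm \<phi>) p \<longleftrightarrow>
     q \<bullet> p = dual_norm \<phi> p \<and> (\<forall>r. q \<bullet> r \<le> dual_norm \<phi> r)"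
proof
  assume "q \<in> subdifferential (dual_norm \<phi>) p"
  then have s: "dual_norm \<phi> p + q \<bullet> (r - p) \<le> dual_norm \<phi> r" for r
    unfolding subdifferential_def by blast
  have "dual_norm \<phi> p \<le> q \<bullet> p" using s[of 0] dual_norm_scale[OF f, of 0] by simp
  moreover have "q \<bullet> p \<le> dual_norm \<phi> p"
    using s[of "2 *\<^sub>R p"] dual_norm_scale[OF f, of 2] by (simp add: inner_diff_right)
  ultimately show "q \<bullet> p = dual_norm \<phi> p \<and> (\<forall>r. q \<bullet> r \<le> dual_norm \<phi> r)"
    using s by (simp add: inner_diff_right)
qed (simp add: subdifferential_def inner_diff_right)

lemma subdifferential_dual_norm_scale:
  fixes \<phi> :: "real^'n \<Rightarrow> real"
  assumes f: "finsler_norm \<phi>" and a: "0 < a"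
  shows "subdifferential (dual_norm \<phi>) (a *\<^sub>R p) = subdifferential (dual_norm \<phi>) p"
  using a dual_norm_scale[OF f, of a p] by (auto simp: subdifferential_dual_norm_iff[OF f])

lemma dual_norm_polar_le_one:
  fixes \<phi> :: "real^'n \<Rightarrow> real"
  assumes f: "finsler_norm \<phi>" and p: "p \<in> polar \<phi>"
  shows "dual_norm \<phi> p \<le> 1"
proof -
  obtain q where q: "\<phi> q \<le> 1" "dual_norm \<phi> p = p \<bullet> q"
    using dual_norm_attained[OF f] by blast
  moreover have "p \<bullet> q \<le> \<phi> q" using p by (simp add: polar_def)
  ultimately show ?thesis by simp
qed

lemma inner_le_dual_norm:
  fixes \<phi> :: "real^'n \<Rightarrow> real"
  assumes f: "finsler_norm \<phi>"
  shows "p \<bullet> x \<le> dual_norm \<phi> p * \<phi> x"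
proof (cases "x = 0")
  case True
  then show ?thesis using finsler_norm_zero[OF f] by simp
next
  case False
  then have pos: "\<phi> x > 0" using f unfolding finsler_norm_def by blast
  have "\<phi> (inverse (\<phi> x) *\<^sub>R x) \<le> 1" using pos finsler_norm_scale[OF f] by simp
  from dual_norm_ge[OF f this, of p] show ?thesis using pos by (simp add: field_simps)
qed

section \<open>Gibbs measures on a convex body\<close>

text \<open>Gibbs measures are taken with respect to Lebesgue measure on \<open>D\<close>, realized as a restricted space,
  so that estimates are needed for points of \<open>D\<close> only, with no almost-everywhere qualification.\<close>
definition partition_fun :: "'a::euclidean_space set \<Rightarrow> ('a \<Rightarrow> real) \<Rightarrow> real" where
  "partition_fun D f = (\<integral>p. exp (f p) \<partial>restrict_space lborel D)"

definition gibbs :: "'a::euclidean_space set \<Rightarrow> ('a \<Rightarrow> real) \<Rightarrow> 'a measure" where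
  "gibbs D f = density (restrict_space lborel D) (\<lambda>p. ennreal (exp (f p) / partition_fun D f))"

lemma restrict_lborel_measurable:
  fixes f :: "'a::euclidean_space \<Rightarrow> 'b::topological_space"
  assumes "continuous_on D f"
  shows "f \<in> borel_measurable (restrict_space lborel D)"
  using borel_measurable_continuous_on_restrict[OF assms]
  by (simp add: measurable_def space_restrict_space sets_restrict_space)

lemma restrict_lborel_integrable:
  fixes f :: "'a::euclidean_space \<Rightarrow> 'b::euclidean_space"
  assumes "compact D" "continuous_on D f"
  shows "integrable (restrict_space lborel D) f"
proof -
  have D: "D \<in> sets borel" using assms(1) by (simp add: compact_imp_closed)
  then have "integrable (restrict_space lborel D) f \<longleftrightarrow> set_integrable lborel D f"
    unfolding set_integrable_def by (intro integrable_restrict_space) simp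
  then show ?thesis using borel_integrable_compact[OF assms] 
    unfolding set_integrable_def by (simp add: indicator_scaleR_eq_if)
qed

lemma integral_mono_restrict:
  fixes f g :: "'a::euclidean_space \<Rightarrow> real"
  assumes "compact D" "continuous_on D f" "continuous_on D g" "\<And>p. p \<in> D \<Longrightarrow> f p \<le> g p"
  shows "integral\<^sup>L (restrict_space lborel D) f \<le> integral\<^sup>L (restrict_space lborel D) g"
  using assms by (intro integral_mono restrict_lborel_integrable) (auto simp: space_restrict_space)

lemma integral_const_restrict:
  fixes c :: real
  assumes "compact (D :: 'a::euclidean_space set)"
  shows "(\<integral>p. c \<partial>restrict_space lborel D) = measure lborel D * c"
proof -
  have "D \<in> sets borel" using assms by (simp add: compact_imp_closed)
  then have "measure (restrict_space lborel D) D = measure lborel D"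
    by (intro measure_restrict_space) auto
  then show ?thesis by (simp add: space_restrict_space)
qed

lemma measure_lborel_compact_pos:
  assumes "compact (D :: 'a::euclidean_space set)" "interior D \<noteq> {}"
  shows "0 < measure lborel D"
proof -
  obtain x e where e: "e > 0" "ball x e \<subseteq> D"
    using assms(2) by (metis all_not_in_conv mem_interior)
  have "0 < measure lborel (ball x e)"
    using e content_ball_pos[of e x] by simp
  also have "\<dots> \<le> measure lborel D"
    using e assms(1) by (intro measure_mono_fmeasurable fmeasurable_compact) auto
  finally show ?thesis .
qed

lemma partition_fun_pos:
  assumes "compact D" "interior D \<noteq> {}" "continuous_on D f"
  shows "0 < partition_fun D f"
proof -
  have "D \<noteq> {}" using assms(2) by auto
  then obtain q where q: "q \<in> D" "\<And>p. p \<in> D \<Longrightarrow> f q \<le> f p"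
    using continuous_attains_inf[OF assms(1) _ assms(3)] by blast
  have "0 < measure lborel D * exp (f q)"
    using measure_lborel_compact_pos[OF assms(1,2)] by simp
  also have "\<dots> = (\<integral>p. exp (f q) \<partial>restrict_space lborel D)"
    by (rule integral_const_restrict[OF assms(1), symmetric])
  also have "\<dots> \<le> partition_fun D f"
    unfolding partition_fun_def using q assms 
    by (intro integral_mono_restrict) (auto intro!: continuous_intros)
  finally show ?thesis .
qed

lemma space_gibbs [simp]: "space (gibbs D f) = D"
  unfolding gibbs_def by (simp add: space_restrict_space)

lemma gibbs_integral:
  fixes g :: "'a::euclidean_space \<Rightarrow> 'b::euclidean_space"
  assumes "compact D" "interior D \<noteq> {}" "continuous_on D f" "continuous_on D g"
  shows "integrable (gibbs D f) g"
    and "integral\<^sup>L (gibbs D f) g = 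
      (\<integral>p. exp (f p) *\<^sub>R g p \<partial>restrict_space lborel D) /\<^sub>R partition_fun D f"
proof -
  note pos = partition_fun_pos[OF assms(1-3)]
  have cE: "continuous_on D (\<lambda>p. exp (f p))"
    by (rule continuous_on_exp[OF assms(3)])
  have cZ: "continuous_on D (\<lambda>p. exp (f p) / partition_fun D f)"
    using continuous_on_divide[OF cE continuous_on_const] pos by force
  have m: "g \<in> borel_measurable (restrict_space lborel D)"
    by (rule restrict_lborel_measurable[OF assms(4)])
  have m2: "(\<lambda>p. exp (f p) / partition_fun D f) \<in> borel_measurable (restrict_space lborel D)"
    by (rule restrict_lborel_measurable[OF cZ])
  have i: "integrable (restrict_space lborel D) (\<lambda>p. exp (f p) *\<^sub>R g p)"
    by (rule restrict_lborel_integrable[OF assms(1) continuous_on_scaleR[OF cE assms(4)]])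
  have eq: "(\<lambda>p. (exp (f p) / partition_fun D f) *\<^sub>R g p) = 
     (\<lambda>p. (1 / partition_fun D f) *\<^sub>R (exp (f p) *\<^sub>R g p))" by (simp add: fun_eq_iff)
  have nn: "AE p in restrict_space lborel D. 0 \<le> exp (f p) / partition_fun D f"
    using pos by simp
  have "integrable (restrict_space lborel D) (\<lambda>p. (exp (f p) / partition_fun D f) *\<^sub>R g p)"
    unfolding eq by (rule integrable_scaleR_right) (rule i)
  then show "integrable (gibbs D f) g"
    unfolding gibbs_def integrable_density[OF m m2 nn] .
  show "integral\<^sup>L (gibbs D f) g = 
      (\<integral>p. exp (f p) *\<^sub>R g p \<partial>restrict_space lborel D) /\<^sub>R partition_fun D f"
    unfolding gibbs_def integral_density[OF m m2 nn] eq integral_scaleR_right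
    by (simp add: inverse_eq_divide)
qed

lemma gibbs_prob_space:
  assumes "compact D" "interior D \<noteq> {}" "continuous_on D f"
  shows "prob_space (gibbs D f)"
proof -
  note pos = partition_fun_pos[OF assms]
  have i: "integrable (restrict_space lborel D) (\<lambda>p. exp (f p) / partition_fun D f)"
    using continuous_on_divide[OF continuous_on_exp[OF assms(3)] continuous_on_const] pos
    by (intro restrict_lborel_integrable[OF assms(1)]) force
  have "emeasure (gibbs D f) (space (gibbs D f)) = 
    (\<integral>\<^sup>+p. ennreal (exp (f p) / partition_fun D f) \<partial>restrict_space lborel D)"
    unfolding gibbs_def using i by (subst emeasure_density) 
      (auto intro!: nn_integral_cong dest: borel_measurable_integrable)
  also have "\<dots> = ennreal (\<integral>p. exp (f p) / partition_fun D f \<partial>restrict_space lborel D)"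
    using i pos by (intro nn_integral_eq_integral) auto
  also have "\<dots> = 1" using pos by (simp add: partition_fun_def)
  finally show ?thesis by (intro prob_spaceI)
qed

lemma partition_fun_perturb:
  assumes "compact D" "interior D \<noteq> {}" "continuous_on D f" "continuous_on D g"
  shows "partition_fun D (\<lambda>p. f p + g p) = partition_fun D f * (\<integral>p. exp (g p) \<partial>gibbs D f)"
proof -
  have "continuous_on D (\<lambda>p. exp (g p))" using assms by (auto intro!: continuous_intros)
  from gibbs_integral(2)[OF assms(1-3) this] partition_fun_pos[OF assms(1-3)]
  show ?thesis by (simp add: partition_fun_def exp_add)
qed

lemma convex_dilation_mem:
  assumes "convex D" "c \<in> D" "p \<in> D" "0 \<le> s" "s \<le> 1"
  shows "c + s *\<^sub>R (p - c) \<in> D"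
proof -
  have "(1 - s) *\<^sub>R c + s *\<^sub>R p \<in> D" using assms by (intro convexD) auto
  then show ?thesis by (simp add: algebra_simps)
qed

text \<open>The contraction of \<open>D\<close> towards \<open>c\<close> by the factor \<open>s\<close> has image inside \<open>D\<close> and Jacobian
  \<open>s^n\<close>.\<close>
lemma dilation_integral:
  fixes G :: "'a::euclidean_space \<Rightarrow> real"
  assumes D: "compact D" "convex D" "c \<in> D" and s: "0 < s" "s \<le> 1"
    and G: "continuous_on D G" "\<And>p. p \<in> D \<Longrightarrow> 0 \<le> G p"
  shows "s ^ DIM('a) * (\<integral>p. G (c + s *\<^sub>R (p - c)) \<partial>restrict_space lborel D)
           \<le> (\<integral>p. G p \<partial>restrict_space lborel D)"
proof -
  have Db: "D \<in> sets borel" using D by (simp add: compact_imp_closed)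
  define t where "t = c - s *\<^sub>R c"
  have t: "c + s *\<^sub>R (p - c) = t + s *\<^sub>R p" for p by (simp add: t_def algebra_simps)
  have inD: "t + s *\<^sub>R p \<in> D" if "p \<in> D" for p
    using convex_dilation_mem[OF D(2,3) that, of s] s t by simp
  define H where "H p = indicator D p *\<^sub>R G p" for p
  have iH: "integrable lborel H"
    unfolding H_def using restrict_lborel_integrable[OF D(1) G(1)] Db
    by (subst (asm) integrable_restrict_space) auto
  have mH: "H \<in> borel_measurable borel" using borel_measurable_integrable[OF iH] by simp
  have "(\<integral>p. H p \<partial>lborel) = (\<integral>p. H p \<partial>density (distr lborel borel (\<lambda>x. t + s *\<^sub>R x)) (\<lambda>_. \<bar>s\<bar>^DIM('a)))"
    using lborel_affine[of s t] s by simp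
  also have "\<dots> = s ^ DIM('a) * (\<integral>p. H (t + s *\<^sub>R p) \<partial>lborel)"
    using s mH by (subst integral_density) (auto simp: integral_distr)
  finally have e1: "(\<integral>p. H p \<partial>lborel) = s ^ DIM('a) * (\<integral>p. H (t + s *\<^sub>R p) \<partial>lborel)" .
  have iH2: "integrable lborel (\<lambda>p. H (t + s *\<^sub>R p))"
  proof -
    have "integrable (density (distr lborel borel (\<lambda>x. t + s *\<^sub>R x)) (\<lambda>_. \<bar>s\<bar>^DIM('a))) H"
      using lborel_affine[of s t] s iH by simp
    then show ?thesis using s mH by (subst (asm) integrable_density) (auto simp: integrable_distr_eq)
  qed
  have c1: "continuous_on D (\<lambda>p. G (t + s *\<^sub>R p))"
    by (rule continuous_on_compose2[OF G(1)]) (use inD in \<open>auto intro!: continuous_intros\<close>)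
  have i2: "integrable lborel (\<lambda>p. indicator D p *\<^sub>R G (t + s *\<^sub>R p))"
    using restrict_lborel_integrable[OF D(1) c1] Db
    by (subst (asm) integrable_restrict_space) auto
  have "(\<integral>p. indicator D p *\<^sub>R G (t + s *\<^sub>R p) \<partial>lborel) \<le> (\<integral>p. H (t + s *\<^sub>R p) \<partial>lborel)"
    by (rule integral_mono[OF i2 iH2]) (auto simp: H_def indicator_def inD G(2))
  then show ?thesis
    using e1 s Db by (subst (1 2) integral_restrict_space) (auto simp: H_def t)
qed

text \<open>Split according to whether the deviation from the mean exceeds \<open>t\<close>. Below \<open>t\<close> its square is at
  most \<open>t\<close> times its modulus, whose expectation is at most twice the mean of the nonnegative
  variable \<open>a - Z\<close>; above \<open>t\<close> its square is at most its fourth power over \<open>t\<^sup>2\<close>. So if \<open>Z\<close> stays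
  below a level close to its mean, the variance is much smaller than concentration alone predicts.\<close>
lemma (in prob_space) variance_le_fourth_moment:
  fixes Z :: "'a \<Rightarrow> real"
  assumes i: "integrable M Z" "integrable M (\<lambda>x. Z x ^ 2)" "integrable M (\<lambda>x. Z x ^ 4)"
    "integrable M (\<lambda>x. (Z x - expectation Z) ^ 4)"
    and a: "\<And>x. x \<in> space M \<Longrightarrow> Z x \<le> a" and t: "t > 0"
  shows "expectation (\<lambda>x. (Z x - expectation Z) ^ 2)
           \<le> 2 * t * (a - expectation Z) + 16 * expectation (\<lambda>x. Z x ^ 4) / t ^ 2"
proof -
  define c where "c = expectation Z"
  have sq: "(expectation f) ^ 2 \<le> expectation (\<lambda>x. f x ^ 2)"
    if "integrable M f" "integrable M (\<lambda>x. f x ^ 2)" for f :: "'a \<Rightarrow> real"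
  proof -
    have "0 \<le> expectation (\<lambda>x. (f x - expectation f) ^ 2)" by (intro Bochner_Integration.integral_nonneg) simp
    also have "\<dots> = expectation (\<lambda>x. f x ^ 2) - (expectation f) ^ 2"
      using that by (rule variance_eq)
    finally show ?thesis by simp
  qed
  have c4: "c ^ 4 \<le> expectation (\<lambda>x. Z x ^ 4)"
  proof -
    have "c ^ 4 = (c ^ 2) ^ 2" by simp
    also have "\<dots> \<le> (expectation (\<lambda>x. Z x ^ 2)) ^ 2"
      using sq[OF i(1,2)] by (intro power_mono) (auto simp: c_def)
    also have "\<dots> \<le> expectation (\<lambda>x. (Z x ^ 2) ^ 2)"
      using i by (intro sq) simp_all
    finally show ?thesis by simp
  qed
  have pw: "(Z x - c) ^ 4 \<le> 8 * Z x ^ 4 + 8 * c ^ 4" for x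
  proof -
    have "(Z x - c) ^ 2 \<le> 2 * (Z x ^ 2 + c ^ 2)"
      using zero_le_power2[of "Z x + c"] by (simp add: power2_eq_square algebra_simps)
    then have "((Z x - c) ^ 2) ^ 2 \<le> (2 * (Z x ^ 2 + c ^ 2)) ^ 2" by (intro power_mono) auto
    also have "\<dots> \<le> 8 * ((Z x ^ 2) ^ 2 + (c ^ 2) ^ 2)"
      using zero_le_power2[of "Z x ^ 2 - c ^ 2"] by (simp add: power2_eq_square algebra_simps)
    finally show ?thesis by simp
  qed
  have "(Z x - c) ^ 2 \<le> t * \<bar>Z x - c\<bar> + (Z x - c) ^ 4 / t ^ 2" for x
  proof (cases "\<bar>Z x - c\<bar> \<le> t")
    case True
    have "(Z x - c) ^ 2 = \<bar>Z x - c\<bar> * \<bar>Z x - c\<bar>" by (simp add: power2_eq_square)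
    also have "\<dots> \<le> t * \<bar>Z x - c\<bar>" using True by (intro mult_right_mono) auto
    finally show ?thesis using t by (auto intro: add_increasing2)
  next
    case False
    then have "t ^ 2 \<le> \<bar>Z x - c\<bar> ^ 2" using t by (intro power_mono) auto
    then have "t ^ 2 * (Z x - c) ^ 2 \<le> (Z x - c) ^ 2 * (Z x - c) ^ 2"
      by (intro mult_right_mono) auto
    then have "t ^ 2 * (Z x - c) ^ 2 \<le> (Z x - c) ^ 4"
      by (simp add: power_add[symmetric])
    then have "(Z x - c) ^ 2 \<le> (Z x - c) ^ 4 / t ^ 2" using t by (simp add: field_simps)
    then show ?thesis using t by (auto intro: add_increasing)
  qed
  moreover have "\<bar>Z x - c\<bar> \<le> (a - Z x) + (a - c)" if "x \<in> space M" for x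
  proof -
    have "c \<le> a" unfolding c_def using i(1) a
      by (metis integral_le_const AE_I2)
    then show ?thesis using a[OF that] by auto
  qed
  ultimately have "(Z x - c) ^ 2 \<le> t * ((a - Z x) + (a - c)) + (8 * Z x ^ 4 + 8 * c ^ 4) / t ^ 2"
    if "x \<in> space M" for x
    using t that pw[of x]
    by (smt (verit) divide_right_mono mult_left_mono zero_le_power2)
  then have "expectation (\<lambda>x. (Z x - c) ^ 2)
     \<le> expectation (\<lambda>x. t * ((a - Z x) + (a - c)) + (8 * Z x ^ 4 + 8 * c ^ 4) / t ^ 2)"
    using i by (intro integral_mono) (auto simp: power2_diff)
  also have "\<dots> = t * (2 * (a - c)) + (8 * expectation (\<lambda>x. Z x ^ 4) + 8 * c ^ 4) / t ^ 2"
    using i by (simp add: c_def prob_space)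
  also have "\<dots> \<le> t * (2 * (a - c)) + (16 * expectation (\<lambda>x. Z x ^ 4)) / t ^ 2"
    using c4 t by (intro add_left_mono divide_right_mono) auto
  finally show ?thesis by (simp add: c_def algebra_simps)
qed

text \<open>Dilating \<open>D\<close> by \<open>1/2\<close> towards the point \<open>c\<close> loses a factor \<open>2^n\<close> of volume, while the midpoint
  inequality shows that at the dilated point the gap \<open>f c - f p\<close> is at most halved. All moments of
  the gap are thus bounded in terms of the dimension alone, when \<open>c\<close> maximizes a concave \<open>f\<close>.\<close>
lemma gibbs_exp_half_bound:
  fixes f :: "'a::euclidean_space \<Rightarrow> real"
  assumes D: "compact D" "interior D \<noteq> {}" "convex D" and f: "continuous_on D f"
    and c: "c \<in> D"
    and mid: "\<And>p. p \<in> D \<Longrightarrow> (f c + f p) / 2 \<le> f (c + (1/2) *\<^sub>R (p - c))"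
  shows "(\<integral>p. exp ((f c - f p) / 2) \<partial>gibbs D f) \<le> 2 ^ DIM('a)"
proof -
  note pos = partition_fun_pos[OF D(1,2) f]
  have inD: "c + (1/2) *\<^sub>R (p - c) \<in> D" if "p \<in> D" for p
    using convex_dilation_mem[OF D(3) c that, of "1/2"] by simp
  have cont: "continuous_on D (\<lambda>p. f (c + (1/2) *\<^sub>R (p - c)))"
    by (rule continuous_on_compose2[OF f]) (use inD in \<open>auto intro!: continuous_intros\<close>)
  have "(1/2) ^ DIM('a) * (\<integral>p. exp ((f c + f p) / 2) \<partial>restrict_space lborel D)
     \<le> (1/2) ^ DIM('a) * (\<integral>p. exp (f (c + (1/2) *\<^sub>R (p - c))) \<partial>restrict_space lborel D)"
    using mid by (intro mult_left_mono integral_mono_restrict D(1)) (auto intro!: continuous_intros f cont)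
  also have "\<dots> \<le> partition_fun D f"
    unfolding partition_fun_def
    by (rule dilation_integral[OF D(1,3) c, of "1/2" "\<lambda>p. exp (f p)"]) (auto intro!: continuous_intros f)
  finally have "(\<integral>p. exp ((f c + f p) / 2) \<partial>restrict_space lborel D) / partition_fun D f \<le> 2 ^ DIM('a)"
    using pos by (simp add: field_simps)
  moreover have "(\<integral>p. exp ((f c - f p) / 2) \<partial>gibbs D f) = 
      (\<integral>p. exp ((f c + f p) / 2) \<partial>restrict_space lborel D) / partition_fun D f"
  proof -
    have "continuous_on D (\<lambda>p. exp ((f c - f p) / 2))" by (auto intro!: continuous_intros f)
    note E = gibbs_integral(2)[OF D(1,2) f this]
    have eq: "exp (f p) *\<^sub>R exp ((f c - f p) / 2) = exp ((f c + f p) / 2)" for p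
    proof -
      have "f p + (f c - f p) / 2 = (f c + f p) / 2" by argo
      then show ?thesis by (simp only: real_scaleR_def exp_add[symmetric])
    qed
    show ?thesis unfolding E eq by (simp only: real_scaleR_def divide_inverse mult.commute)
  qed
  ultimately show ?thesis by simp
qed

definition gibbs_mean :: "'a::euclidean_space set \<Rightarrow> ('a \<Rightarrow> real) \<Rightarrow> 'a" where
  "gibbs_mean D f = (\<integral>p. p \<partial>gibbs D f)"

definition gibbs_cov :: "'a::euclidean_space set \<Rightarrow> ('a \<Rightarrow> real) \<Rightarrow> 'a \<Rightarrow> 'a" where
  "gibbs_cov D f h = (\<integral>p. ((p - gibbs_mean D f) \<bullet> h) *\<^sub>R (p - gibbs_mean D f) \<partial>gibbs D f)"

context
  fixes D :: "'a::euclidean_space set" and f :: "'a \<Rightarrow> real"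
  assumes D: "compact D" "interior D \<noteq> {}" and f: "continuous_on D f"
begin

lemmas gibbs_integrable = gibbs_integral(1)[OF D f]

lemma gibbs_mean_inner: "(\<integral>p. p \<bullet> h \<partial>gibbs D f) = gibbs_mean D f \<bullet> h"
  unfolding gibbs_mean_def
  by (rule integral_inner_left) (auto intro!: gibbs_integrable continuous_intros)

lemma gibbs_cov_inner:
  "gibbs_cov D f h \<bullet> k = (\<integral>p. ((p - gibbs_mean D f) \<bullet> h) * ((p - gibbs_mean D f) \<bullet> k) \<partial>gibbs D f)"
  unfolding gibbs_cov_def
  by (subst integral_inner_left[symmetric]) (auto intro!: gibbs_integrable continuous_intros)

lemma gibbs_cov_symmetric: "gibbs_cov D f h \<bullet> k = h \<bullet> gibbs_cov D f k"
  by (simp add: gibbs_cov_inner inner_commute[of h] mult.commute)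

lemma gibbs_cov_linear: "linear (gibbs_cov D f)"
proof (rule linearI)
  have "gibbs_cov D f (h + k) \<bullet> v = (gibbs_cov D f h + gibbs_cov D f k) \<bullet> v" for h k v
    by (simp add: gibbs_cov_symmetric inner_add_left)
  then show "gibbs_cov D f (h + k) = gibbs_cov D f h + gibbs_cov D f k" for h k
    using vector_eq_rdot by blast
  have "gibbs_cov D f (r *\<^sub>R h) \<bullet> v = (r *\<^sub>R gibbs_cov D f h) \<bullet> v" for r h v
    by (simp add: gibbs_cov_symmetric)
  then show "gibbs_cov D f (r *\<^sub>R h) = r *\<^sub>R gibbs_cov D f h" for r h
    using vector_eq_rdot by blast
qed

text \<open>The increment of \<open>ln Z\<close> is the log-Laplace transform of the Gibbs measure. Estimating the
  exponential of the centred variable \<open>xi\<close> by its Taylor polynomial, then using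
  \<open>ln y \<le> y - 1\<close>, gives the second-order bound directly, with no differentiation under the
  integral sign.\<close>
lemma log_partition_fun_expansion:
  "\<exists>C. \<forall>h. norm h \<le> K \<longrightarrow>
     ln (partition_fun D f) + gibbs_mean D f \<bullet> h \<le> ln (partition_fun D (\<lambda>p. f p + p \<bullet> h)) \<and>
     ln (partition_fun D (\<lambda>p. f p + p \<bullet> h)) \<le>
       ln (partition_fun D f) + gibbs_mean D f \<bullet> h + gibbs_cov D f h \<bullet> h / 2 + C * norm h ^ 3"
proof -
  interpret prob_space "gibbs D f" by (rule gibbs_prob_space[OF D f])
  have pD: "measure (gibbs D f) D = 1" using prob_space by simp
  define m where "m = gibbs_mean D f"
  have "bounded ((\<lambda>p. p - m) ` D)"
    by (intro compact_imp_bounded compact_continuous_image continuous_intros D)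
  then obtain B where B: "\<And>p. p \<in> D \<Longrightarrow> norm (p - m) \<le> B" "B > 0"
    unfolding bounded_pos by auto
  have main: "ln (partition_fun D f) + m \<bullet> h \<le> ln (partition_fun D (\<lambda>p. f p + p \<bullet> h)) \<and>
     ln (partition_fun D (\<lambda>p. f p + p \<bullet> h)) \<le>
       ln (partition_fun D f) + m \<bullet> h + gibbs_cov D f h \<bullet> h / 2 + (exp (B * K) * B ^ 3) * norm h ^ 3"
    if h: "norm h \<le> K" for h
  proof -
    define xi where "xi p = (p - m) \<bullet> h" for p
    have cxi: "continuous_on D xi" unfolding xi_def by (intro continuous_intros)
    have ixi: "integrable (gibbs D f) (\<lambda>p. exp (xi p))" "integrable (gibbs D f) xi"
      "integrable (gibbs D f) (\<lambda>p. xi p ^ 2)"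
      by (auto intro!: gibbs_integrable continuous_intros cxi)
    have mean0: "(\<integral>p. xi p \<partial>gibbs D f) = 0"
    proof -
      have "integrable (gibbs D f) (\<lambda>p. p \<bullet> h)" by (intro gibbs_integrable continuous_intros)
      then have "(\<integral>p. xi p \<partial>gibbs D f) = gibbs_mean D f \<bullet> h - m \<bullet> h"
        unfolding xi_def inner_diff_left by (simp add: gibbs_mean_inner pD)
      then show ?thesis by (simp add: m_def)
    qed
    have var: "(\<integral>p. xi p ^ 2 \<partial>gibbs D f) = gibbs_cov D f h \<bullet> h"
      unfolding gibbs_cov_inner xi_def m_def by (simp add: power2_eq_square)
    have ax: "\<bar>xi p\<bar> \<le> B * norm h" if "p \<in> D" for p
    proof -
      have "\<bar>xi p\<bar> \<le> norm (p - m) * norm h" unfolding xi_def by (rule Cauchy_Schwarz_ineq2)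
      also have "\<dots> \<le> B * norm h" using B(1)[OF that] by (intro mult_right_mono) auto
      finally show ?thesis .
    qed
    have up: "exp (xi p) \<le> 1 + xi p + xi p ^ 2 / 2 + exp (B * K) * B ^ 3 * norm h ^ 3"
      if p: "p \<in> D" for p
    proof -
      obtain t where t: "\<bar>t\<bar> \<le> \<bar>xi p\<bar>" "exp (xi p) = (\<Sum>m<3. xi p ^ m / fact m) + exp t / fact 3 * xi p ^ 3"
        using Maclaurin_exp_le[of "xi p" 3] by blast
      have "B * norm h \<le> B * K" using h B(2) by (intro mult_left_mono) auto
      then have tK: "exp t \<le> exp (B * K)" using t(1) ax[OF p] by auto
      have "exp t / fact 3 * xi p ^ 3 \<le> exp t / fact 3 * \<bar>xi p\<bar> ^ 3"
        by (intro mult_left_mono) (auto simp flip: power_abs)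
      also have "\<dots> \<le> exp (B * K) * (B * norm h) ^ 3"
      proof (intro mult_mono power_mono ax[OF p])
        have "exp t / fact 3 \<le> exp t" by (simp add: fact_numeral)
        then show "exp t / fact 3 \<le> exp (B * K)" using tK by linarith
      qed auto
      finally have "exp t / fact 3 * xi p ^ 3 \<le> exp (B * K) * B ^ 3 * norm h ^ 3"
        by (simp only: power_mult_distrib mult.assoc)
      moreover have "(\<Sum>m<3. xi p ^ m / fact m) = 1 + xi p + xi p ^ 2 / 2"
        by (simp add: eval_nat_numeral)
      ultimately show ?thesis using t(2) by linarith
    qed
    have E: "partition_fun D (\<lambda>p. f p + p \<bullet> h) = partition_fun D f * (exp (m \<bullet> h) * (\<integral>p. exp (xi p) \<partial>gibbs D f))"
    proof -
      have "(\<integral>p. exp (p \<bullet> h) \<partial>gibbs D f) = (\<integral>p. exp (m \<bullet> h) * exp (xi p) \<partial>gibbs D f)"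
        by (simp add: xi_def inner_diff_left flip: exp_add)
      then show ?thesis
        using partition_fun_perturb[OF D f, of "\<lambda>p. p \<bullet> h"] by (simp add: continuous_intros)
    qed
    have "1 = (\<integral>p. 1 + xi p \<partial>gibbs D f)" using ixi by (simp add: mean0 pD)
    also have "\<dots> \<le> (\<integral>p. exp (xi p) \<partial>gibbs D f)"
      using ixi by (intro integral_mono) auto
    finally have ge: "1 \<le> (\<integral>p. exp (xi p) \<partial>gibbs D f)" .
    have "(\<integral>p. exp (xi p) \<partial>gibbs D f) \<le> (\<integral>p. 1 + xi p + xi p ^ 2 / 2 + exp (B * K) * B ^ 3 * norm h ^ 3 \<partial>gibbs D f)"
      using ixi up by (intro integral_mono) auto
    also have "\<dots> = 1 + gibbs_cov D f h \<bullet> h / 2 + exp (B * K) * B ^ 3 * norm h ^ 3"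
      using ixi by (simp add: mean0 pD var)
    finally have le: "(\<integral>p. exp (xi p) \<partial>gibbs D f) \<le> 1 + gibbs_cov D f h \<bullet> h / 2 + exp (B * K) * B ^ 3 * norm h ^ 3" .
    have "ln (partition_fun D (\<lambda>p. f p + p \<bullet> h)) = ln (partition_fun D f) + m \<bullet> h + ln (\<integral>p. exp (xi p) \<partial>gibbs D f)"
      using partition_fun_pos[OF D f] ge unfolding E by (subst ln_mult_pos; simp add: ln_mult_pos)+
    moreover have "ln (\<integral>p. exp (xi p) \<partial>gibbs D f) \<le> (\<integral>p. exp (xi p) \<partial>gibbs D f) - 1"
      using ge by (intro ln_le_minus_one) auto
    ultimately show ?thesis using ge le by auto
  qed
  then show ?thesis unfolding m_def by blast
qed

end

section \<open>A smooth approximation of the norm\<close>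

definition soft_exponent :: "real \<Rightarrow> real \<Rightarrow> real^'n \<Rightarrow> real^'n \<Rightarrow> real" where
  "soft_exponent \<epsilon> \<delta> x p = (p \<bullet> x - \<epsilon> / 2 * (p \<bullet> p)) / \<delta>"

text \<open>As \<open>\<delta>\<close> tends to \<open>0\<close>, this tends to the supremum of \<open>\<langle>p, x\<rangle> - \<epsilon> |p|\<^sup>2 / 2\<close> over the polar body,
  which is the Moreau envelope of \<open>\<phi>\<close> with parameter \<open>\<epsilon>\<close>.\<close>
definition soft_norm :: "(real^'n \<Rightarrow> real) \<Rightarrow> real \<Rightarrow> real \<Rightarrow> real^'n \<Rightarrow> real" where
  "soft_norm \<phi> \<epsilon> \<delta> x = \<delta> * ln (partition_fun (polar \<phi>) (soft_exponent \<epsilon> \<delta> x))"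

context
  fixes \<phi> :: "real^'n \<Rightarrow> real" and \<epsilon> \<delta> :: real
  assumes f: "finsler_norm \<phi>" and eps: "\<epsilon> > 0" and del: "\<delta> > 0"
begin

lemma continuous_on_soft_exponent: "continuous_on S (soft_exponent \<epsilon> \<delta> x)"
  unfolding soft_exponent_def using del by (intro continuous_intros) auto

lemmas polar_gibbs = compact_polar[OF f] interior_polar[OF f] continuous_on_soft_exponent

lemma soft_norm_expansion:
  fixes x :: "real^'n"
  defines "m \<equiv> gibbs_mean (polar \<phi>) (soft_exponent \<epsilon> \<delta> x)"
  defines "V \<equiv> gibbs_cov (polar \<phi>) (soft_exponent \<epsilon> \<delta> x)"
  shows "\<exists>C. \<forall>h. norm h \<le> 1 \<longrightarrow>
     soft_norm \<phi> \<epsilon> \<delta> x + m \<bullet> h \<le> soft_norm \<phi> \<epsilon> \<delta> (x + h) \<and>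
     soft_norm \<phi> \<epsilon> \<delta> (x + h) \<le> soft_norm \<phi> \<epsilon> \<delta> x + m \<bullet> h + V h \<bullet> h / \<delta> / 2 + C * norm h ^ 3"
proof -
  let ?e = "soft_exponent \<epsilon> \<delta> x"
  let ?L = "\<lambda>e. ln (partition_fun (polar \<phi>) e)"
  obtain C where C: "\<And>h. norm h \<le> 1 / \<delta> \<Longrightarrow>
     ?L ?e + m \<bullet> h \<le> ?L (\<lambda>p. ?e p + p \<bullet> h) \<and>
     ?L (\<lambda>p. ?e p + p \<bullet> h) \<le> ?L ?e + m \<bullet> h + V h \<bullet> h / 2 + C * norm h ^ 3"
    using log_partition_fun_expansion[OF polar_gibbs, of "1 / \<delta>"] unfolding m_def V_def by blast
  have "soft_norm \<phi> \<epsilon> \<delta> x + m \<bullet> h \<le> soft_norm \<phi> \<epsilon> \<delta> (x + h) \<and>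
     soft_norm \<phi> \<epsilon> \<delta> (x + h) \<le> soft_norm \<phi> \<epsilon> \<delta> x + m \<bullet> h + V h \<bullet> h / \<delta> / 2
       + (\<delta> * C / \<delta> ^ 3) * norm h ^ 3"
    if h: "norm h \<le> 1" for h
  proof -
    have shift: "soft_exponent \<epsilon> \<delta> (x + h) = (\<lambda>p. ?e p + p \<bullet> (h /\<^sub>R \<delta>))"
      using del by (simp add: fun_eq_iff soft_exponent_def inner_add_right field_simps)
    have lin: "linear V" unfolding V_def by (rule gibbs_cov_linear[OF polar_gibbs])
    have "norm (h /\<^sub>R \<delta>) \<le> 1 / \<delta>" using h del by (simp add: field_simps)
    from C[OF this] have
      "\<delta> * (?L ?e + m \<bullet> (h /\<^sub>R \<delta>)) \<le> soft_norm \<phi> \<epsilon> \<delta> (x + h) \<and>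
       soft_norm \<phi> \<epsilon> \<delta> (x + h) \<le> 
         \<delta> * (?L ?e + m \<bullet> (h /\<^sub>R \<delta>) + V (h /\<^sub>R \<delta>) \<bullet> (h /\<^sub>R \<delta>) / 2 + C * norm (h /\<^sub>R \<delta>) ^ 3)"
      using del unfolding soft_norm_def shift by (auto intro!: mult_left_mono)
    moreover have "\<delta> * (?L ?e + m \<bullet> (h /\<^sub>R \<delta>)) = soft_norm \<phi> \<epsilon> \<delta> x + m \<bullet> h"
      using del by (simp add: soft_norm_def field_simps)
    moreover have "\<delta> * (V (h /\<^sub>R \<delta>) \<bullet> (h /\<^sub>R \<delta>) / 2) = V h \<bullet> h / \<delta> / 2"
      using del by (simp add: linear_cmul[OF lin] field_simps)
    moreover have "\<delta> * (C * norm (h /\<^sub>R \<delta>) ^ 3) = (\<delta> * C / \<delta> ^ 3) * norm h ^ 3"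
      using del by (simp add: power_divide power_mult_distrib field_simps)
    ultimately show ?thesis by (simp only: distrib_left)
  qed
  then show ?thesis by blast
qed

lemma continuous_on_soft_norm: "continuous_on S (soft_norm \<phi> \<epsilon> \<delta>)"
proof (rule continuous_at_imp_continuous_on, rule ballI)
  fix x
  define m where "m = gibbs_mean (polar \<phi>) (soft_exponent \<epsilon> \<delta> x)"
  define V where "V = gibbs_cov (polar \<phi>) (soft_exponent \<epsilon> \<delta> x)"
  obtain C where C: "\<And>h. norm h \<le> 1 \<Longrightarrow>
     soft_norm \<phi> \<epsilon> \<delta> x + m \<bullet> h \<le> soft_norm \<phi> \<epsilon> \<delta> (x + h) \<and>
     soft_norm \<phi> \<epsilon> \<delta> (x + h) \<le> soft_norm \<phi> \<epsilon> \<delta> x + m \<bullet> h + V h \<bullet> h / \<delta> / 2 + C * norm h ^ 3"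
    using soft_norm_expansion[of x] unfolding m_def V_def by blast
  have "bounded_linear V"
    unfolding V_def linear_conv_bounded_linear[symmetric] by (rule gibbs_cov_linear[OF polar_gibbs])
  then have V: "(V \<longlongrightarrow> V 0) (at 0)" "V 0 = 0"
    using linear_continuous_at[of V 0] by (auto simp: isCont_def linear_simps)
  have ev: "\<forall>\<^sub>F h in at (0::real^'n). norm h \<le> 1"
    unfolding eventually_at by (intro exI[of _ 1]) (auto simp: dist_norm)
  have "((\<lambda>h. soft_norm \<phi> \<epsilon> \<delta> (x + h)) \<longlongrightarrow> soft_norm \<phi> \<epsilon> \<delta> x) (at 0)"
  proof (rule tendsto_sandwich)
    show "\<forall>\<^sub>F h in at 0. soft_norm \<phi> \<epsilon> \<delta> x + m \<bullet> h \<le> soft_norm \<phi> \<epsilon> \<delta> (x + h)"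
      using ev by eventually_elim (use C in blast)
    show "\<forall>\<^sub>F h in at 0. soft_norm \<phi> \<epsilon> \<delta> (x + h) \<le>
        soft_norm \<phi> \<epsilon> \<delta> x + m \<bullet> h + V h \<bullet> h / \<delta> / 2 + C * norm h ^ 3"
      using ev by eventually_elim (use C in blast)
    show "((\<lambda>h. soft_norm \<phi> \<epsilon> \<delta> x + m \<bullet> h) \<longlongrightarrow> soft_norm \<phi> \<epsilon> \<delta> x) (at 0)"
      by (rule tendsto_eq_intros refl | simp)+
    show "((\<lambda>h. soft_norm \<phi> \<epsilon> \<delta> x + m \<bullet> h + V h \<bullet> h / \<delta> / 2 + C * norm h ^ 3)
        \<longlongrightarrow> soft_norm \<phi> \<epsilon> \<delta> x) (at 0)"
      using del by (auto intro!: tendsto_eq_intros V(1) simp: V(2))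
  qed
  then show "isCont (soft_norm \<phi> \<epsilon> \<delta>) x" by (simp add: isCont_iff)
qed

text \<open>The upper bound replaces the exponent by its bound \<open>\<phi> x / \<delta>\<close>. For the lower bound, the integral
  is restricted to the copy of the polar body shrunk by the factor \<open>\<delta>\<close> towards a point that
  supports \<open>\<phi>\<close> at \<open>x\<close>; there the exponent is nearly \<open>\<phi> x / \<delta>\<close>, and the lost volume
  contributes \<open>\<delta> n ln \<delta>\<close>.\<close>
lemma soft_norm_approx:
  assumes del1: "\<delta> \<le> 1" and x: "norm x \<le> R" and rho: "\<And>p. p \<in> polar \<phi> \<Longrightarrow> norm p \<le> \<rho>"
  defines "v \<equiv> measure lborel (polar \<phi>)"
  shows "soft_norm \<phi> \<epsilon> \<delta> x \<le> \<phi> x + \<delta> * ln v"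
    and "\<phi> x - 2 * \<delta> * \<rho> * R - \<epsilon> / 2 * \<rho> ^ 2 + \<delta> * (CARD('n) * ln \<delta>) + \<delta> * ln v \<le> soft_norm \<phi> \<epsilon> \<delta> x"
proof -
  let ?D = "polar \<phi>" and ?e = "soft_exponent \<epsilon> \<delta> x"
  let ?Z = "partition_fun ?D ?e"
  have v: "v > 0" unfolding v_def by (rule measure_lborel_compact_pos[OF polar_gibbs(1,2)])
  have Z: "?Z > 0" by (rule partition_fun_pos[OF polar_gibbs])
  have ce: "continuous_on S (\<lambda>p. exp (?e p))" for S
    by (intro continuous_on_exp continuous_on_soft_exponent)
  have "?e p \<le> \<phi> x / \<delta>" if p: "p \<in> ?D" for p
  proof -
    have "p \<bullet> x \<le> \<phi> x" using p by (simp add: polar_def)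
    moreover have "0 \<le> \<epsilon> / 2 * (p \<bullet> p)" using eps by simp
    ultimately have "p \<bullet> x - \<epsilon> / 2 * (p \<bullet> p) \<le> \<phi> x" by linarith
    then show ?thesis unfolding soft_exponent_def using del by (intro divide_right_mono) auto
  qed
  then have "?Z \<le> (\<integral>p. exp (\<phi> x / \<delta>) \<partial>restrict_space lborel ?D)"
    unfolding partition_fun_def
    by (intro integral_mono_restrict polar_gibbs ce continuous_on_const) auto
  also have "\<dots> = v * exp (\<phi> x / \<delta>)" unfolding v_def by (rule integral_const_restrict[OF polar_gibbs(1)])
  finally have "ln ?Z \<le> ln (v * exp (\<phi> x / \<delta>))" using Z by simp
  also have "\<dots> = ln v + \<phi> x / \<delta>" using v by (simp add: ln_mult_pos)
  finally have "\<delta> * ln ?Z \<le> \<delta> * (ln v + \<phi> x / \<delta>)" using del by (intro mult_left_mono) auto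
  then show "soft_norm \<phi> \<epsilon> \<delta> x \<le> \<phi> x + \<delta> * ln v"
    using del by (simp add: soft_norm_def distrib_left)
  obtain c where c: "c \<in> ?D" "c \<bullet> x = \<phi> x" using polar_supports[OF f] by blast
  define a where "a = (\<phi> x - 2 * \<delta> * \<rho> * R - \<epsilon> / 2 * \<rho> ^ 2) / \<delta>"
  have low: "a \<le> ?e (c + \<delta> *\<^sub>R (p - c))" if p: "p \<in> ?D" for p
  proof -
    let ?p = "c + \<delta> *\<^sub>R (p - c)"
    have "?p \<in> ?D" by (rule convex_dilation_mem[OF convex_polar c(1) p]) (use del del1 in auto)
    then have "norm ?p ^ 2 \<le> \<rho> ^ 2" using rho by (intro power_mono) auto
    then have "\<epsilon> / 2 * (?p \<bullet> ?p) \<le> \<epsilon> / 2 * \<rho> ^ 2"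
      using eps unfolding power2_norm_eq_inner by (intro mult_left_mono) auto
    moreover have "\<phi> x - 2 * \<delta> * \<rho> * R \<le> ?p \<bullet> x"
    proof -
      have "(c - p) \<bullet> x \<le> norm (c - p) * norm x" by (rule norm_cauchy_schwarz)
      also have "\<dots> \<le> (2 * \<rho>) * R"
        using norm_triangle_ineq4[of c p] rho[OF c(1)] rho[OF p] x norm_ge_zero[of c] norm_ge_zero[of x]
        by (intro mult_mono) linarith+
      finally have "\<delta> * ((c - p) \<bullet> x) \<le> \<delta> * (2 * \<rho> * R)" using del by (intro mult_left_mono) auto
      then show ?thesis using c(2) by (simp add: inner_add_left inner_diff_left algebra_simps)
    qed
    ultimately have "\<phi> x - 2 * \<delta> * \<rho> * R - \<epsilon> / 2 * \<rho> ^ 2 \<le> ?p \<bullet> x - \<epsilon> / 2 * (?p \<bullet> ?p)" by linarith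
    then show ?thesis unfolding a_def soft_exponent_def using del by (intro divide_right_mono) auto
  qed
  have "v * exp a = (\<integral>p. exp a \<partial>restrict_space lborel ?D)"
    unfolding v_def by (rule integral_const_restrict[OF polar_gibbs(1), symmetric])
  also have "\<dots> \<le> (\<integral>p. exp (?e (c + \<delta> *\<^sub>R (p - c))) \<partial>restrict_space lborel ?D)"
    using low by (intro integral_mono_restrict polar_gibbs(1) continuous_on_const
        continuous_on_compose2[OF ce[of UNIV]] continuous_intros) auto
  finally have "\<delta> ^ CARD('n) * (v * exp a) 
      \<le> \<delta> ^ CARD('n) * (\<integral>p. exp (?e (c + \<delta> *\<^sub>R (p - c))) \<partial>restrict_space lborel ?D)"
    using del by (intro mult_left_mono) auto
  also have "\<dots> \<le> ?Z"
    unfolding partition_fun_def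
    using dilation_integral[OF polar_gibbs(1) convex_polar c(1) del del1 ce] by simp
  finally have "\<delta> ^ CARD('n) * (v * exp a) \<le> ?Z" .
  then have "ln (\<delta> ^ CARD('n) * (v * exp a)) \<le> ln ?Z"
    by (rule ln_mono) (use v del in simp)
  moreover have "ln (\<delta> ^ CARD('n) * (v * exp a)) = CARD('n) * ln \<delta> + (ln v + a)"
    using v del by (simp add: ln_mult_pos ln_realpow)
  ultimately have "\<delta> * (CARD('n) * ln \<delta> + (ln v + a)) \<le> soft_norm \<phi> \<epsilon> \<delta> x"
    unfolding soft_norm_def using del by (intro mult_left_mono) auto
  moreover have "\<delta> * a = \<phi> x - 2 * \<delta> * \<rho> * R - \<epsilon> / 2 * \<rho> ^ 2"
    unfolding a_def using del by simp
  ultimately show "\<phi> x - 2 * \<delta> * \<rho> * R - \<epsilon> / 2 * \<rho> ^ 2 + \<delta> * (CARD('n) * ln \<delta>) + \<delta> * ln v \<le> soft_norm \<phi> \<epsilon> \<delta> x"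
    by (simp add: distrib_left)
qed

text \<open>The maximizer \<open>c\<close> of the exponent is the projection of \<open>x / \<epsilon>\<close> to the polar body; \<open>y\<close> is the
  proximal point of \<open>x\<close> for \<open>\<epsilon> \<phi>\<close>, and the variational inequality of the projection says that \<open>c\<close> is a
  subgradient of \<open>\<phi>\<close> at \<open>y\<close>. The optimality gap is then a sum of two nonnegative terms: the first
  controls \<open>1 - \<phi>\<^sup>*\<close> of the mean, the second the distance to \<open>c\<close>.\<close>
lemma polar_prox:
  obtains c y where "c \<in> polar \<phi>" "y = x - \<epsilon> *\<^sub>R c" "c \<bullet> y = \<phi> y"
    "\<And>p. soft_exponent \<epsilon> \<delta> x c - soft_exponent \<epsilon> \<delta> x p =
        ((\<phi> y - p \<bullet> y) + \<epsilon> / 2 * norm (p - c) ^ 2) / \<delta>"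
proof -
  define c where "c = closest_point (polar \<phi>) (x /\<^sub>R \<epsilon>)"
  define y where "y = x - \<epsilon> *\<^sub>R c"
  have cl: "closed (polar \<phi>)" using compact_polar[OF f] by (rule compact_imp_closed)
  have ne: "polar \<phi> \<noteq> {}" using interior_polar[OF f] interior_subset by blast
  have c: "c \<in> polar \<phi>" unfolding c_def by (rule closest_point_in_set[OF cl ne])
  have "p \<bullet> y \<le> c \<bullet> y" if "p \<in> polar \<phi>" for p
  proof -
    have "(x /\<^sub>R \<epsilon> - c) \<bullet> (p - c) \<le> 0"
      unfolding c_def by (rule closest_point_dot[OF convex_polar cl that])
    then have "\<epsilon> * ((x /\<^sub>R \<epsilon> - c) \<bullet> (p - c)) \<le> 0" using eps by (simp add: mult_le_0_iff)
    moreover have "\<epsilon> * ((x /\<^sub>R \<epsilon> - c) \<bullet> (p - c)) = y \<bullet> (p - c)"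
      using eps by (simp add: y_def inner_diff_left right_diff_distrib)
    ultimately show ?thesis by (simp add: inner_diff_right inner_commute)
  qed
  moreover obtain p where "p \<in> polar \<phi>" "p \<bullet> y = \<phi> y" using polar_supports[OF f] by blast
  ultimately have "\<phi> y \<le> c \<bullet> y" by metis
  moreover have "c \<bullet> y \<le> \<phi> y" using c by (simp add: polar_def)
  ultimately have cy: "c \<bullet> y = \<phi> y" by simp
  have phi_y: "\<phi> y = c \<bullet> x - \<epsilon> * (c \<bullet> c)" unfolding cy[symmetric] by (simp add: y_def inner_diff_right)
  have "soft_exponent \<epsilon> \<delta> x c - soft_exponent \<epsilon> \<delta> x p =
        ((\<phi> y - p \<bullet> y) + \<epsilon> / 2 * norm (p - c) ^ 2) / \<delta>" for p
    unfolding phi_y unfolding soft_exponent_def y_def power2_norm_eq_inner diff_divide_distrib[symmetric]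
    by (rule arg_cong[where f = "\<lambda>t. t / \<delta>"])
      (simp add: inner_diff_left inner_diff_right inner_commute field_simps)
  then show thesis using that c y_def cy by blast
qed

end

text \<open>The optimality gap \<open>Y\<close> has moments bounded by the dimension. Its linear part shows that the mean
  \<open>m\<close> has \<open>\<phi>\<^sup>*(m) \<ge> 1 - O(\<delta>)\<close>, tested with the direction \<open>y\<close>; its quadratic part bounds the fourth
  moment of \<open>|p - c|\<close>. The free threshold \<open>\<tau>\<close> is that of \<open>variance_le_fourth_moment\<close>, applied to
  \<open>Z p = \<langle>p - c, q\<rangle>\<close>: since \<open>\<langle>p, q\<rangle> \<le> \<phi>\<^sup>*(p) \<le> 1\<close> on the polar body, \<open>Z\<close> stays below
  \<open>1 - \<langle>c, q\<rangle>\<close>, which exceeds the mean of \<open>Z\<close> by \<open>1 - \<phi>\<^sup>*(m)\<close> only.\<close>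
lemma soft_norm_degenerate:
  fixes \<phi> :: "real^'n \<Rightarrow> real" and x :: "real^'n"
  assumes f: "finsler_norm \<phi>" and eps: "\<epsilon> > 0" and del: "\<delta> > 0" and tau: "\<tau> > 0"
    and s: "s > 0" and phi_s: "\<And>c. c \<in> polar \<phi> \<Longrightarrow> s \<le> \<phi> (x - \<epsilon> *\<^sub>R c)"
    and q: "q \<in> subdifferential (dual_norm \<phi>) (gibbs_mean (polar \<phi>) (soft_exponent \<epsilon> \<delta> x))"
    and b: "norm q \<le> b"
  defines "m \<equiv> gibbs_mean (polar \<phi>) (soft_exponent \<epsilon> \<delta> x)"
  defines "V \<equiv> gibbs_cov (polar \<phi>) (soft_exponent \<epsilon> \<delta> x)"
  defines "N \<equiv> 2 ^ CARD('n)"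
  shows "1 - 2 * N * \<delta> / s \<le> q \<bullet> m"
    and "V q \<bullet> q / \<delta> \<le> 4 * N * \<tau> / s + 512 * N * b ^ 4 * \<delta> / (\<epsilon> ^ 2 * \<tau> ^ 2)"
proof -
  let ?D = "polar \<phi>" and ?e = "soft_exponent \<epsilon> \<delta> x"
  note pg = polar_gibbs[OF f eps del]
  note D = pg(1,2) and ce = pg(3)
  interpret prob_space "gibbs ?D ?e" by (rule gibbs_prob_space[OF D ce])
  have pD: "prob ?D = 1" using prob_space by simp
  note int = gibbs_integral(1)[OF D ce]
  obtain c y where c: "c \<in> ?D" and y: "y = x - \<epsilon> *\<^sub>R c" and cy: "c \<bullet> y = \<phi> y"
    and diff: "\<And>p. ?e c - ?e p = ((\<phi> y - p \<bullet> y) + \<epsilon> / 2 * norm (p - c) ^ 2) / \<delta>"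
    using polar_prox[OF f eps del] by blast
  define Y where "Y p = ?e c - ?e p" for p
  have cY: "continuous_on S Y" for S
    unfolding Y_def by (intro continuous_intros continuous_on_soft_exponent[OF f eps del])
  have gap: "\<phi> y - p \<bullet> y \<ge> 0" if "p \<in> ?D" for p using that by (simp add: polar_def)
  have Y1: "\<phi> y - p \<bullet> y \<le> \<delta> * Y p" if "p \<in> ?D" for p
    unfolding Y_def diff using del eps by simp
  have Y2: "norm (p - c) ^ 2 \<le> 2 * \<delta> / \<epsilon> * Y p" if "p \<in> ?D" for p
    unfolding Y_def diff using del eps gap[OF that] by (simp add: field_simps)
  have Y0: "Y p \<ge> 0" if "p \<in> ?D" for p
    unfolding Y_def diff using del eps gap[OF that] by simp
  have half: "expectation (\<lambda>p. exp (Y p / 2)) \<le> N"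
  proof -
    have mid: "(?e c + ?e p) / 2 \<le> ?e (c + (1/2) *\<^sub>R (p - c))" if p: "p \<in> ?D" for p
    proof -
      let ?p = "c + (1/2) *\<^sub>R (p - c)"
      have "\<phi> y - ?p \<bullet> y = (\<phi> y - p \<bullet> y) / 2"
        using cy by (simp add: inner_add_left inner_diff_left field_simps)
      moreover have "norm (?p - c) ^ 2 = norm (p - c) ^ 2 / 4" by (simp add: power_divide)
      ultimately have "Y ?p = ((\<phi> y - p \<bullet> y) / 2 + \<epsilon> / 2 * (norm (p - c) ^ 2 / 4)) / \<delta>"
        unfolding Y_def diff by (simp only:)
      also have "\<dots> \<le> ((\<phi> y - p \<bullet> y) / 2 + \<epsilon> / 2 * (norm (p - c) ^ 2 / 2)) / \<delta>"
        using del eps by (intro divide_right_mono add_left_mono mult_left_mono) auto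
      also have "\<dots> = Y p / 2" unfolding Y_def diff using del by (simp add: field_simps)
      finally show ?thesis by (simp add: Y_def)
    qed
    show ?thesis using gibbs_exp_half_bound[OF D convex_polar ce c mid] by (simp add: Y_def N_def)
  qed
  have iE: "integrable (gibbs ?D ?e) (\<lambda>p. exp (Y p / 2))"
    by (rule int) (intro continuous_intros cY, simp)
  have Yexp: "Y p \<le> 2 * exp (Y p / 2)" for p
    using exp_ge_add_one_self[of "Y p / 2"] by linarith
  have Yexp2: "Y p ^ 2 \<le> 8 * exp (Y p / 2)" if "p \<in> ?D" for p
  proof -
    have "1 + Y p / 2 + (Y p / 2) ^ 2 / 2 \<le> exp (Y p / 2)"
      using Y0[OF that] by (intro exp_lower_Taylor_quadratic) simp
    then show ?thesis using Y0[OF that] by (simp add: power_divide)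
  qed
  have sy: "s \<le> \<phi> y" using phi_s[OF c] y by simp
  have mi: "expectation (\<lambda>p. p \<bullet> h) = m \<bullet> h" for h
    unfolding m_def by (rule gibbs_mean_inner[OF D ce])
  have deficit: "1 - q \<bullet> m \<le> 2 * N * \<delta> / s"
  proof -
    have "\<phi> y - m \<bullet> y = expectation (\<lambda>p. \<phi> y - p \<bullet> y)"
      by (simp add: int continuous_intros mi pD)
    also have "\<dots> \<le> expectation (\<lambda>p. 2 * \<delta> * exp (Y p / 2))"
    proof (rule integral_mono)
      show "\<phi> y - p \<bullet> y \<le> 2 * \<delta> * exp (Y p / 2)" if "p \<in> space (gibbs ?D ?e)" for p
      proof -
        have "\<delta> * Y p \<le> \<delta> * (2 * exp (Y p / 2))" by (intro mult_left_mono Yexp) (use del in simp)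
        also have "\<dots> = 2 * \<delta> * exp (Y p / 2)" by simp
        finally show ?thesis using Y1[of p] that by simp
      qed
    qed (use iE in \<open>auto intro!: int continuous_intros\<close>)
    also have "\<dots> = 2 * \<delta> * expectation (\<lambda>p. exp (Y p / 2))" by simp
    also have "\<dots> \<le> 2 * \<delta> * N" using half del by (intro mult_left_mono) auto
    finally have "\<phi> y - m \<bullet> y \<le> 2 * N * \<delta>" by (simp add: mult_ac)
    moreover have "m \<bullet> y \<le> (q \<bullet> m) * \<phi> y"
      using inner_le_dual_norm[OF f, of m y] q by (simp add: subdifferential_dual_norm_iff[OF f] m_def)
    ultimately have *: "(1 - q \<bullet> m) * \<phi> y \<le> 2 * N * \<delta>" by (simp add: algebra_simps)
    show ?thesis
    proof (cases "q \<bullet> m \<le> 1")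
      case True
      then have "(1 - q \<bullet> m) * s \<le> (1 - q \<bullet> m) * \<phi> y" using sy by (intro mult_left_mono) auto
      with * have "(1 - q \<bullet> m) * s \<le> 2 * N * \<delta>" by linarith
      then show ?thesis using s by (simp add: field_simps)
    next
      case False
      moreover have "0 \<le> 2 * N * \<delta> / s" using del s by (simp add: N_def)
      ultimately show ?thesis by linarith
    qed
  qed
  then show "1 - 2 * N * \<delta> / s \<le> q \<bullet> m" by simp
  have b0: "0 \<le> b" using b norm_ge_zero order_trans by blast
  define Z where "Z p = (p - c) \<bullet> q" for p
  have cZ: "continuous_on S Z" for S unfolding Z_def by (intro continuous_intros)
  have EZ: "expectation Z = m \<bullet> q - c \<bullet> q"
    unfolding Z_def inner_diff_left by (simp add: int continuous_intros mi pD)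
  have Zle: "Z p \<le> 1 - c \<bullet> q" if "p \<in> space (gibbs ?D ?e)" for p
  proof -
    have "q \<bullet> p \<le> dual_norm \<phi> p" using q by (simp add: subdifferential_dual_norm_iff[OF f])
    also have "\<dots> \<le> 1" using dual_norm_polar_le_one[OF f] that by simp
    finally show ?thesis by (simp add: Z_def inner_diff_left inner_commute[of q])
  qed
  define k where "k = b ^ 4 * (2 * \<delta> / \<epsilon>) ^ 2 * 8"
  have Z4: "expectation (\<lambda>p. Z p ^ 4) \<le> k * N"
  proof -
    have "Z p ^ 4 \<le> k * exp (Y p / 2)" if p: "p \<in> ?D" for p
    proof -
      have "\<bar>Z p\<bar> \<le> norm (p - c) * norm q" unfolding Z_def by (rule Cauchy_Schwarz_ineq2)
      also have "\<dots> \<le> norm (p - c) * b" using b by (intro mult_left_mono) auto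
      finally have "\<bar>Z p\<bar> ^ 4 \<le> (norm (p - c) * b) ^ 4" by (intro power_mono) auto
      then have "Z p ^ 4 \<le> b ^ 4 * (norm (p - c) ^ 2) ^ 2" by (simp add: power_mult_distrib mult_ac)
      also have "\<dots> \<le> b ^ 4 * (2 * \<delta> / \<epsilon> * Y p) ^ 2"
        using Y2[OF p] by (intro mult_left_mono power_mono) auto
      also have "\<dots> = b ^ 4 * (2 * \<delta> / \<epsilon>) ^ 2 * Y p ^ 2" by (simp only: power_mult_distrib mult.assoc)
      also have "\<dots> \<le> b ^ 4 * (2 * \<delta> / \<epsilon>) ^ 2 * (8 * exp (Y p / 2))"
        using Yexp2[OF p] by (intro mult_left_mono) auto
      finally show ?thesis by (simp add: k_def mult_ac)
    qed
    then have "expectation (\<lambda>p. Z p ^ 4) \<le> expectation (\<lambda>p. k * exp (Y p / 2))"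
      using iE by (intro integral_mono int continuous_intros cZ cY) auto
    also have "\<dots> = k * expectation (\<lambda>p. exp (Y p / 2))" by simp
    also have "\<dots> \<le> k * N" using half by (intro mult_left_mono) (auto simp: k_def)
    finally show ?thesis .
  qed
  have "V q \<bullet> q = expectation (\<lambda>p. (Z p - expectation Z) ^ 2)"
    unfolding V_def gibbs_cov_inner[OF D ce] m_def[symmetric] EZ
    by (simp add: Z_def inner_diff_left power2_eq_square)
  also have "\<dots> \<le> 2 * \<tau> * ((1 - c \<bullet> q) - expectation Z) + 16 * expectation (\<lambda>p. Z p ^ 4) / \<tau> ^ 2"
    by (rule variance_le_fourth_moment[OF _ _ _ _ Zle tau]) (auto intro!: int continuous_intros cZ)
  also have "\<dots> \<le> 2 * \<tau> * (2 * N * \<delta> / s) + 16 * (k * N) / \<tau> ^ 2"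
    using deficit Z4 tau
    by (intro add_mono mult_left_mono divide_right_mono) (auto simp: EZ inner_commute)
  finally have "V q \<bullet> q / \<delta> \<le> (2 * \<tau> * (2 * N * \<delta> / s) + 16 * (k * N) / \<tau> ^ 2) / \<delta>"
    using del by (intro divide_right_mono) auto
  also have "\<dots> = 4 * N * \<tau> / s + 512 * N * b ^ 4 * \<delta> / (\<epsilon> ^ 2 * \<tau> ^ 2)"
    using del eps tau s by (simp add: k_def field_simps power2_eq_square)
  finally show "V q \<bullet> q / \<delta> \<le> 4 * N * \<tau> / s + 512 * N * b ^ 4 * \<delta> / (\<epsilon> ^ 2 * \<tau> ^ 2)" .
qed

text \<open>Everything known about the regularization that the comparison argument uses: uniform closeness
  to \<open>\<phi>\<close> on a ball and, away from the vertex, second-order bounds whose Hessian nearly vanishes on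
  \<open>\<partial>\<phi>\<^sup>*\<close> of the gradient. The scales \<open>\<delta> = t\<^sup>8\<close>, \<open>\<epsilon> = t\<^sup>2\<close>, \<open>\<tau> = t\<close> turn the two error terms of
  \<open>soft_norm_degenerate\<close> into \<open>O(t)\<close> and \<open>O(t\<^sup>2)\<close>.\<close>
lemma soft_cone_exists:
  fixes \<phi> :: "real^'n \<Rightarrow> real"
  assumes f: "finsler_norm \<phi>" and r: "0 < r" and kappa: "0 < \<kappa>"
  obtains w where "continuous_on UNIV w"
    "\<And>x. norm x \<le> R \<Longrightarrow> \<bar>w x - \<phi> x\<bar> \<le> \<kappa>"
    "\<And>x. r \<le> norm x \<Longrightarrow> \<exists>m T C. linear T \<and> (\<forall>h k. T h \<bullet> k = h \<bullet> T k) \<and>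
       (\<forall>h. norm h \<le> 1 \<longrightarrow> w x + m \<bullet> h \<le> w (x + h) \<and>
            w (x + h) \<le> w x + m \<bullet> h + T h \<bullet> h / 2 + C * norm h ^ 3) \<and>
       (\<forall>q\<in>subdifferential (dual_norm \<phi>) m. 1/2 \<le> q \<bullet> m \<and> T q \<bullet> q \<le> \<kappa>)"
proof -
  obtain \<rho> where rho: "\<rho> > 0" "\<And>p. p \<in> polar \<phi> \<Longrightarrow> norm p \<le> \<rho>"
    using compact_imp_bounded[OF compact_polar[OF f]] unfolding bounded_pos by blast
  obtain b where "b > 0" and "\<And>s. \<phi> s \<le> 1 \<Longrightarrow> norm s \<le> b"
    using compact_imp_bounded[OF finsler_ball_compact[OF f]] unfolding bounded_pos by auto
  then have b: "\<And>q p. q \<in> subdifferential (dual_norm \<phi>) p \<Longrightarrow> norm q \<le> b"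
    using subdifferential_dual_norm_bound[OF f] by blast
  obtain c where c: "c > 0" "\<And>x. c * norm x \<le> \<phi> x" using finsler_norm_coercive[OF f] by blast
  define v where "v = measure lborel (polar \<phi>)"
  define n where "n = real CARD('n)"
  define N :: real where "N = 2 ^ CARD('n)"
  define s where "s = c * (r / 2)"
  have s: "s > 0" using c r by (simp add: s_def)
  \<comment> \<open>The total error in the lower bound of \<open>soft_norm_approx\<close> at the scales chosen for \<open>t\<close>.\<close>
  define lo where "lo t = 2 * t ^ 8 * \<rho> * R + t ^ 2 / 2 * \<rho> ^ 2 - t ^ 8 * (n * ln (t ^ 8)) - t ^ 8 * ln v" for t
  have small: "\<forall>\<^sub>F t in at_right 0. g t < e" if "(g \<longlongrightarrow> 0) (at_right 0)" "e > 0" for g and e :: real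
    using order_tendstoD(2)[OF that] .
  have "((\<lambda>t. t ^ 8 * ln v) \<longlongrightarrow> 0) (at_right 0)" by (rule tendsto_eq_intros refl | simp)+
  note E1 = small[OF this kappa]
  have log: "((\<lambda>t::real. t ^ 8 * ln (t ^ 8)) \<longlongrightarrow> 0) (at_right 0)" by real_asymp
  have "((\<lambda>t. 2 * t ^ 8 * \<rho> * R + t ^ 2 / 2 * \<rho> ^ 2 - n * (t ^ 8 * ln (t ^ 8)) - t ^ 8 * ln v) \<longlongrightarrow> 0) (at_right 0)"
    by (rule tendsto_eq_intros log refl | simp)+
  then have "(lo \<longlongrightarrow> 0) (at_right 0)" by (simp add: lo_def[abs_def] mult_ac)
  note E2 = small[OF this kappa]
  have "((\<lambda>t. t ^ 2 * \<rho>) \<longlongrightarrow> 0) (at_right 0)" by (rule tendsto_eq_intros refl | simp)+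
  then have E3: "\<forall>\<^sub>F t in at_right 0. t ^ 2 * \<rho> < r / 2"
    by (rule small) (use r in simp)
  have "((\<lambda>t. 2 * N * t ^ 8 / s) \<longlongrightarrow> 0) (at_right 0)" using s by (auto intro!: tendsto_eq_intros)
  then have E4: "\<forall>\<^sub>F t in at_right 0. 2 * N * t ^ 8 / s < 1 / 2" by (rule small) simp
  have "((\<lambda>t. 4 * N * t / s + 512 * N * b ^ 4 * t ^ 2) \<longlongrightarrow> 0) (at_right 0)"
    using s by (auto intro!: tendsto_eq_intros)
  note E5 = small[OF this kappa]
  have E6: "\<forall>\<^sub>F t in at_right (0::real). 0 < t \<and> t < 1"
    by (rule eventually_mono[OF eventually_at_right_real[of 0 1]]) auto
  obtain t where t: "t ^ 8 * ln v < \<kappa>" "lo t < \<kappa>" "t ^ 2 * \<rho> < r / 2" "2 * N * t ^ 8 / s < 1 / 2"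
    "4 * N * t / s + 512 * N * b ^ 4 * t ^ 2 < \<kappa>" "0 < t" "t < 1"
    using eventually_happens'[OF _ eventually_conj[OF E1 eventually_conj[OF E2 eventually_conj[OF E3
      eventually_conj[OF E4 eventually_conj[OF E5 E6]]]]]]
    by auto
  have eps: "t ^ 2 > 0" and del: "t ^ 8 > 0" "t ^ 8 \<le> 1" using t by (auto simp: power_le_one)
  let ?w = "soft_norm \<phi> (t ^ 2) (t ^ 8)"
  show thesis
  proof (rule that)
    show "continuous_on UNIV ?w" by (rule continuous_on_soft_norm[OF f eps del(1)])
    show "\<bar>?w x - \<phi> x\<bar> \<le> \<kappa>" if x: "norm x \<le> R" for x
      using soft_norm_approx[OF f eps del x rho(2)] t(1,2)
      by (simp add: lo_def v_def n_def abs_le_iff)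
    fix x :: "real^'n" assume x: "r \<le> norm x"
    let ?D = "polar \<phi>" and ?e = "soft_exponent (t ^ 2) (t ^ 8) x"
    note pg = polar_gibbs[OF f eps del(1)]
    define m where "m = gibbs_mean ?D ?e"
    define T where "T h = gibbs_cov ?D ?e h /\<^sub>R t ^ 8" for h
    have lin: "linear T"
      unfolding T_def by (intro linear_compose_scale_right gibbs_cov_linear[OF pg])
    have sym: "T h \<bullet> k = h \<bullet> T k" for h k
      unfolding T_def using gibbs_cov_symmetric[OF pg] by simp
    have Td: "T h \<bullet> k = gibbs_cov ?D ?e h \<bullet> k / t ^ 8" for h k
      by (simp add: T_def divide_inverse)
    obtain C where C: "\<forall>h. norm h \<le> 1 \<longrightarrow> ?w x + m \<bullet> h \<le> ?w (x + h) \<and>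
            ?w (x + h) \<le> ?w x + m \<bullet> h + T h \<bullet> h / 2 + C * norm h ^ 3"
      using soft_norm_expansion[OF f eps del(1), of x] unfolding Td m_def by blast
    have "1/2 \<le> q \<bullet> m \<and> T q \<bullet> q \<le> \<kappa>" if q: "q \<in> subdifferential (dual_norm \<phi>) m" for q
    proof -
      have sle: "s \<le> \<phi> (x - t ^ 2 *\<^sub>R p)" if p: "p \<in> ?D" for p
      proof -
        have "norm (t ^ 2 *\<^sub>R p) \<le> t ^ 2 * \<rho>" using rho(2)[OF p] by (simp add: mult_left_mono)
        then have "r / 2 \<le> norm (x - t ^ 2 *\<^sub>R p)"
          using t(3) x norm_triangle_ineq2[of x "t ^ 2 *\<^sub>R p"] by linarith
        then have "s \<le> c * norm (x - t ^ 2 *\<^sub>R p)" unfolding s_def using c(1) by (intro mult_left_mono) auto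
        then show ?thesis using c(2) order_trans by blast
      qed
      note deg = soft_norm_degenerate[OF f eps del(1) t(6) s sle q[unfolded m_def] b[OF q], folded N_def]
      have "512 * N * b ^ 4 * t ^ 8 / ((t ^ 2) ^ 2 * t ^ 2) = 512 * N * b ^ 4 * t ^ 2"
        using t(6) by (simp add: field_simps flip: power_add power_mult)
      then show ?thesis using deg t(4,5) unfolding Td m_def by auto
    qed
    then show "\<exists>m T C. linear T \<and> (\<forall>h k. T h \<bullet> k = h \<bullet> T k) \<and>
       (\<forall>h. norm h \<le> 1 \<longrightarrow> ?w x + m \<bullet> h \<le> ?w (x + h) \<and>
            ?w (x + h) \<le> ?w x + m \<bullet> h + T h \<bullet> h / 2 + C * norm h ^ 3) \<and>
       (\<forall>q\<in>subdifferential (dual_norm \<phi>) m. 1/2 \<le> q \<bullet> m \<and> T q \<bullet> q \<le> \<kappa>)"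
      using lin sym C by blast
  qed
qed

section \<open>Comparison with cones\<close>

lemma USC_uminus: "u \<in> USC U \<Longrightarrow> (\<lambda>x. - u x) \<in> LSC U"
  unfolding USC_def LSC_def
proof clarify
  fix x a assume u: "\<forall>x\<in>U. \<forall>a. u x < a \<longrightarrow> (\<forall>\<^sub>F y in at x within U. u y < a)"
    and "x \<in> U" "a < - u x"
  then have "\<forall>\<^sub>F y in at x within U. u y < - a" by simp
  then show "\<forall>\<^sub>F y in at x within U. a < - u y" by eventually_elim simp
qed

lemma LSC_uminus: "v \<in> LSC U \<Longrightarrow> (\<lambda>x. - v x) \<in> USC U"
  unfolding USC_def LSC_def
proof clarify
  fix x a assume v: "\<forall>x\<in>U. \<forall>a. a < v x \<longrightarrow> (\<forall>\<^sub>F y in at x within U. a < v y)"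
    and "x \<in> U" "- v x < a"
  then have "\<forall>\<^sub>F y in at x within U. - a < v y" by simp
  then show "\<forall>\<^sub>F y in at x within U. - v y < a" by eventually_elim simp
qed

text \<open>With \<open>a\<close> the increment of \<open>w\<close>, that of \<open>l w - k w\<^sup>2\<close> is exactly \<open>(l - 2 k w(x)) a - k a\<^sup>2\<close>. The
  upper bound on \<open>a\<close> serves in the first term, whose factor is nonnegative; in the second,
  both bounds show that \<open>a\<^sup>2\<close> is \<open>\<langle>m, h\<rangle>\<^sup>2\<close> up to third order. The term with \<open>\<nu>\<close> absorbs all third-order
  errors.\<close>
lemma concave_barrier_quadratic_bound:
  fixes w :: "real^'n \<Rightarrow> real"
  assumes T: "linear T" and k: "k > 0" and g: "0 \<le> l - 2 * k * w x" and nu: "\<nu> > 0"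
    and w: "\<And>h. norm h \<le> 1 \<Longrightarrow> w x + m \<bullet> h \<le> w (x + h) \<and>
            w (x + h) \<le> w x + m \<bullet> h + T h \<bullet> h / 2 + C * norm h ^ 3"
  obtains d where "d > 0" "\<And>h. norm h < d \<Longrightarrow>
     (l * w (x + h) - k * w (x + h) ^ 2) - (l * w x - k * w x ^ 2)
       \<le> (l - 2 * k * w x) * (m \<bullet> h)
          + ((l - 2 * k * w x) * (T h \<bullet> h) - 2 * k * (m \<bullet> h) ^ 2 + \<nu> * (h \<bullet> h)) / 2"
proof -
  define g where "g = l - 2 * k * w x"
  obtain Kt where Kt: "Kt > 0" "\<And>h. norm (T h) \<le> norm h * Kt"
    using bounded_linear.pos_bounded T linear_conv_bounded_linear by metis
  define K where "K = Kt / 2 + \<bar>C\<bar>"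
  have K: "K > 0" using Kt by (simp add: K_def)
  define E where "E = g * \<bar>C\<bar> + 2 * k * norm m * K"
  have E: "E \<ge> 0" using K k assms(3) by (simp add: E_def g_def)
  define d where "d = min 1 (\<nu> / (2 * (E + 1)))"
  have d: "d > 0" using nu E by (simp add: d_def)
  show thesis
  proof (rule that[OF d])
    fix h :: "real^'n" assume h: "norm h < d"
    have h1: "norm h \<le> 1" using h by (simp add: d_def)
    define a where "a = w (x + h) - w x"
    define \<rho> where "\<rho> = a - m \<bullet> h"
    have rho0: "0 \<le> \<rho>" and rho1: "\<rho> \<le> T h \<bullet> h / 2 + C * norm h ^ 3"
      using w[OF h1] by (auto simp: \<rho>_def a_def)
    have C1: "C * norm h ^ 3 \<le> \<bar>C\<bar> * norm h ^ 3" by (intro mult_right_mono) auto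
    have "T h \<bullet> h \<le> norm (T h) * norm h" by (rule norm_cauchy_schwarz)
    also have "\<dots> \<le> Kt * norm h ^ 2"
      using mult_right_mono[OF Kt(2)[of h], of "norm h"] by (simp add: power2_eq_square mult_ac)
    finally have "T h \<bullet> h / 2 \<le> Kt / 2 * norm h ^ 2" by simp
    moreover have "\<bar>C\<bar> * norm h ^ 3 \<le> \<bar>C\<bar> * norm h ^ 2"
      using h1 by (intro mult_left_mono power_decreasing) auto
    ultimately have rhoK: "\<rho> \<le> K * norm h ^ 2"
      using rho1 C1 by (simp add: K_def distrib_right)
    have "- (m \<bullet> h) * \<rho> \<le> (norm m * norm h) * (K * norm h ^ 2)"
    proof (intro mult_mono rhoK rho0)
      show "- (m \<bullet> h) \<le> norm m * norm h"
        using Cauchy_Schwarz_ineq2[of m h] by linarith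
    qed auto
    then have cross: "- (m \<bullet> h) * \<rho> \<le> norm m * K * norm h ^ 3"
      by (simp add: power3_eq_cube power2_eq_square mult_ac)
    have sq: "(m \<bullet> h) ^ 2 + 2 * ((m \<bullet> h) * \<rho>) \<le> a ^ 2"
      using zero_le_power2[of \<rho>] by (simp add: \<rho>_def power2_eq_square algebra_simps)
    have "k * (m \<bullet> h) ^ 2 - 2 * k * (norm m * K * norm h ^ 3) \<le> k * a ^ 2"
    proof -
      have "(m \<bullet> h) ^ 2 - 2 * (norm m * K * norm h ^ 3) \<le> a ^ 2" using sq cross by linarith
      then have "k * ((m \<bullet> h) ^ 2 - 2 * (norm m * K * norm h ^ 3)) \<le> k * a ^ 2"
        using k by (intro mult_left_mono) auto
      then show ?thesis by (simp add: algebra_simps)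
    qed
    moreover have "g * a \<le> g * (m \<bullet> h) + g * (T h \<bullet> h) / 2 + g * \<bar>C\<bar> * norm h ^ 3"
    proof -
      have "a \<le> m \<bullet> h + T h \<bullet> h / 2 + \<bar>C\<bar> * norm h ^ 3"
        using rho1 C1 unfolding \<rho>_def by linarith
      then have "g * a \<le> g * (m \<bullet> h + T h \<bullet> h / 2 + \<bar>C\<bar> * norm h ^ 3)"
        using assms(3) by (intro mult_left_mono) (auto simp: g_def)
      then show ?thesis by (simp add: algebra_simps)
    qed
    moreover have "(l * w (x + h) - k * w (x + h) ^ 2) - (l * w x - k * w x ^ 2) = g * a - k * a ^ 2"
      by (simp add: a_def g_def power2_eq_square algebra_simps)
    moreover have "g * \<bar>C\<bar> * norm h ^ 3 + 2 * k * (norm m * K * norm h ^ 3) \<le> \<nu> / 2 * (h \<bullet> h)"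
    proof -
      have "(E + 1) * norm h \<le> (E + 1) * (\<nu> / (2 * (E + 1)))"
        using h E by (intro mult_left_mono) (auto simp: d_def)
      also have "\<dots> = \<nu> / 2" using E by (simp add: field_simps)
      finally have "E * norm h \<le> \<nu> / 2" by (simp add: distrib_right) (smt (verit) norm_ge_zero)
      then have "E * norm h * norm h ^ 2 \<le> \<nu> / 2 * norm h ^ 2" by (intro mult_right_mono) auto
      moreover have "g * \<bar>C\<bar> * norm h ^ 3 + 2 * k * (norm m * K * norm h ^ 3) = E * norm h * norm h ^ 2"
        by (simp add: E_def power3_eq_cube power2_eq_square algebra_simps)
      ultimately show ?thesis by (simp add: power2_norm_eq_inner)
    qed
    ultimately show "(l * w (x + h) - k * w (x + h) ^ 2) - (l * w x - k * w x ^ 2)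
       \<le> (l - 2 * k * w x) * (m \<bullet> h)
          + ((l - 2 * k * w x) * (T h \<bullet> h) - 2 * k * (m \<bullet> h) ^ 2 + \<nu> * (h \<bullet> h)) / 2"
      unfolding g_def[symmetric] by argo
  qed
qed

text \<open>If the maximum over the closure exceeded that over the frontier, \<open>u\<close> minus the smooth concave
  barrier \<open>B\<close> would be maximal at a point \<open>x0\<close> of \<open>V\<close>. There \<open>\<langle>S q, q\<rangle>\<close> is at most
  \<open>g \<langle>T q, q\<rangle> - 2 k \<langle>m, q\<rangle>\<^sup>2 + \<nu> |q|\<^sup>2\<close>, where the middle term is at most \<open>- k / 2\<close> and \<open>\<kappa>\<close>, \<open>\<nu>\<close> are
  chosen so small that each other term is at most \<open>k / 8\<close>.\<close>
lemma quadratic_subsolution_cone_max: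
  fixes \<phi> :: "real^'n \<Rightarrow> real"
  assumes f: "finsler_norm \<phi>" and u: "u \<in> USC U" and sub: "quadratic_subsolution \<phi> U u"
    and V: "open V" "V \<noteq> {}" "compactly_inside V U" and z: "z \<notin> V" and l: "l > 0"
  shows "(SUP x\<in>closure V. u x - l * \<phi> (x - z)) = (SUP x\<in>frontier V. u x - l * \<phi> (x - z))"
proof -
  define Q where "Q x = u x - l * \<phi> (x - z)" for x
  have cl: "compact (closure V)" "closure V \<noteq> {}" "closure V \<subseteq> U"
    using V by (auto simp: compactly_inside_def)
  have fr: "frontier V = closure V - V" using V(1) by (simp add: frontier_def interior_open)
  obtain x1 where x1: "x1 \<in> closure V" "(SUP x\<in>closure V. Q x) = Q x1" "\<forall>x\<in>closure V. Q x \<le> Q x1"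
    using cone_max_attained[OF f u cl, of l z] unfolding Q_def by blast
  obtain x2 where x2: "x2 \<in> frontier V" "(SUP x\<in>frontier V. Q x) = Q x2" "\<forall>x\<in>frontier V. Q x \<le> Q x2"
    using cone_max_attained[OF f u compactly_inside_frontier[OF V(2,3)], of l z] unfolding Q_def by blast
  have "Q x2 \<le> Q x1" using x1(3) x2(1) by (simp add: fr)
  moreover have "\<not> Q x2 < Q x1"
  proof
    assume lt: "Q x2 < Q x1"
    define \<gamma> where "\<gamma> = (Q x1 - Q x2) / 6"
    have gam: "\<gamma> > 0" using lt by (simp add: \<gamma>_def)
    \<comment> \<open>The regularization is controlled off the vertex only, so \<open>x0\<close> has to keep a distance
      from \<open>z\<close>: near \<open>z\<close>, upper semicontinuity and the values on the frontier keep \<open>Q\<close> small.\<close>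
    obtain r where r: "r > 0" "\<And>x. x \<in> closure V \<Longrightarrow> norm (x - z) < r \<Longrightarrow> Q x < Q x2 + \<gamma>"
    proof (cases "z \<in> closure V")
      case True
      then have "z \<in> frontier V" using z by (simp add: fr)
      then have Qz: "u z \<le> Q x2" using x2(3) finsler_norm_zero[OF f] by (force simp: Q_def)
      have "z \<in> U" using True cl by blast
      then have "\<forall>\<^sub>F y in at z within U. u y < u z + \<gamma>" using u gam unfolding USC_def by auto
      then obtain d where d: "d > 0" "\<And>y. y \<in> U \<Longrightarrow> y \<noteq> z \<Longrightarrow> dist y z < d \<Longrightarrow> u y < u z + \<gamma>"
        unfolding eventually_at by blast
      have "Q x < Q x2 + \<gamma>" if x: "x \<in> closure V" "norm (x - z) < d" for x
      proof -
        have "u x < u z + \<gamma>" using d(2)[of x] x cl(3) gam by (cases "x = z") (auto simp: dist_norm)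
        moreover have "0 \<le> l * \<phi> (x - z)" using l finsler_norm_nonneg[OF f] by simp
        ultimately show ?thesis using Qz by (simp add: Q_def)
      qed
      then show thesis using that d(1) by blast
    next
      case False
      then obtain d where "d > 0" "ball z d \<subseteq> - closure V"
        using open_contains_ball[of "- closure V"] by auto
      then have "\<not> norm (x - z) < d" if "x \<in> closure V" for x
        using that by (auto simp: dist_norm norm_minus_commute subset_iff)
      then show thesis using that \<open>d > 0\<close> by blast
    qed
    obtain R where R: "\<And>x. x \<in> closure V \<Longrightarrow> norm (x - z) \<le> R"
    proof -
      have "bounded ((\<lambda>x. x - z) ` closure V)"
        by (intro compact_imp_bounded compact_continuous_image continuous_intros cl(1))
      then show thesis using that unfolding bounded_iff by auto
    qed
    obtain \<Phi> where Phi: "\<Phi> > 0" "\<And>h. norm h \<le> R \<Longrightarrow> \<phi> h \<le> \<Phi>"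
    proof -
      have "bounded (\<phi> ` cball 0 R)"
        by (intro compact_imp_bounded compact_continuous_image finsler_norm_continuous[OF f]) simp
      then obtain a where a: "a > 0" "\<forall>y\<in>\<phi> ` cball 0 R. norm y \<le> a" unfolding bounded_pos by blast
      then show thesis using that[OF a(1)] by (force simp: abs_le_iff)
    qed
    obtain b where b: "b > 0" "\<And>q p. q \<in> subdifferential (dual_norm \<phi>) p \<Longrightarrow> norm q \<le> b"
    proof -
      obtain b where "b > 0" "\<And>s. \<phi> s \<le> 1 \<Longrightarrow> norm s \<le> b"
        using compact_imp_bounded[OF finsler_ball_compact[OF f]] unfolding bounded_pos by auto
      then show thesis using that subdifferential_dual_norm_bound[OF f] by blast
    qed
    \<comment> \<open>The first bound makes the perturbation \<open>k w\<^sup>2\<close> at most \<open>\<gamma>\<close>, the second keeps the derivative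
      of \<open>s \<mapsto> l s - k s\<^sup>2\<close> positive on the range of \<open>w\<close>. Only then is \<open>\<kappa>\<close> fixed, depending on \<open>k\<close>.\<close>
    define k where "k = min (\<gamma> / (\<Phi> + 1) ^ 2) (l / (4 * (\<Phi> + 1)))"
    have k: "k > 0" using gam l Phi by (simp add: k_def)
    have k1: "k * (\<Phi> + 1) ^ 2 \<le> \<gamma>"
    proof -
      have "k \<le> \<gamma> / (\<Phi> + 1) ^ 2" by (simp add: k_def)
      then show ?thesis using Phi(1) by (simp add: pos_le_divide_eq)
    qed
    have k2: "4 * (k * (\<Phi> + 1)) \<le> l"
    proof -
      have "k \<le> l / (4 * (\<Phi> + 1))" by (simp add: k_def)
      then have "k * (4 * (\<Phi> + 1)) \<le> l" using Phi(1) by (simp add: pos_le_divide_eq)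
      then show ?thesis by (simp add: mult_ac)
    qed
    define \<kappa> where "\<kappa> = min 1 (min (\<gamma> / l) (k / (8 * (l + 2 * k))))"
    have kap: "\<kappa> > 0" "\<kappa> \<le> 1" "l * \<kappa> \<le> \<gamma>" "(l + 2 * k) * \<kappa> \<le> k / 8"
    proof -
      show "\<kappa> > 0" "\<kappa> \<le> 1" using gam l k by (auto simp: \<kappa>_def)
      have "\<kappa> \<le> \<gamma> / l" by (simp add: \<kappa>_def)
      then show "l * \<kappa> \<le> \<gamma>" using l by (simp add: pos_le_divide_eq mult.commute)
      have "\<kappa> \<le> k / (8 * (l + 2 * k))" by (simp add: \<kappa>_def)
      then have "\<kappa> * (8 * (l + 2 * k)) \<le> k" using l k by (simp add: pos_le_divide_eq)
      then show "(l + 2 * k) * \<kappa> \<le> k / 8" by (simp add: algebra_simps)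
    qed
    define \<nu> where "\<nu> = k / (8 * b ^ 2)"
    have nu: "\<nu> > 0" "\<nu> * b ^ 2 = k / 8" using k b(1) by (auto simp: \<nu>_def)
    obtain w where w: "continuous_on UNIV w" "\<And>x. norm x \<le> R \<Longrightarrow> \<bar>w x - \<phi> x\<bar> \<le> \<kappa>"
      and wT: "\<And>x. r \<le> norm x \<Longrightarrow> \<exists>m T C. linear T \<and> (\<forall>h k. T h \<bullet> k = h \<bullet> T k) \<and>
       (\<forall>h. norm h \<le> 1 \<longrightarrow> w x + m \<bullet> h \<le> w (x + h) \<and>
            w (x + h) \<le> w x + m \<bullet> h + T h \<bullet> h / 2 + C * norm h ^ 3) \<and>
       (\<forall>q\<in>subdifferential (dual_norm \<phi>) m. 1/2 \<le> q \<bullet> m \<and> T q \<bullet> q \<le> \<kappa>)"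
      using soft_cone_exists[OF f r(1) kap(1), of R] by blast
    define B where "B x = l * w (x - z) - k * w (x - z) ^ 2" for x
    have wb: "-1 \<le> w (x - z)" "w (x - z) \<le> \<Phi> + 1" "\<bar>B x - l * \<phi> (x - z)\<bar> \<le> 2 * \<gamma>"
      if x: "x \<in> closure V" for x
    proof -
      note wk = w(2)[OF R[OF x]]
      show w1: "-1 \<le> w (x - z)" "w (x - z) \<le> \<Phi> + 1"
        using wk kap(2) Phi(2)[OF R[OF x]] finsler_norm_nonneg[OF f, of "x - z"] by auto
      have "w (x - z) ^ 2 \<le> (\<Phi> + 1) ^ 2" using w1 Phi(1) by (intro abs_le_square_iff[THEN iffD1]) auto
      then have "k * w (x - z) ^ 2 \<le> k * (\<Phi> + 1) ^ 2" using k by (intro mult_left_mono) auto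
      then have "k * w (x - z) ^ 2 \<le> \<gamma>" using k1 by linarith
      moreover have "\<bar>l * w (x - z) - l * \<phi> (x - z)\<bar> \<le> \<gamma>"
      proof -
        have "\<bar>l * (w (x - z) - \<phi> (x - z))\<bar> \<le> l * \<kappa>" using wk l by (simp add: abs_mult)
        then show ?thesis using kap(3) by (simp add: right_diff_distrib)
      qed
      moreover have "0 \<le> k * w (x - z) ^ 2" using k by simp
      ultimately show "\<bar>B x - l * \<phi> (x - z)\<bar> \<le> 2 * \<gamma>" unfolding B_def by linarith
    qed
    have cB: "continuous_on U B"
      unfolding B_def by (intro continuous_intros continuous_on_compose2[OF w(1)]) auto
    obtain x0 where x0: "x0 \<in> closure V" "\<And>y. y \<in> closure V \<Longrightarrow> u y - B y \<le> u x0 - B x0"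
      using LSC_attains_inf[OF USC_uminus[OF u] cl cB] by force
    have Q0: "Q x2 + 2 * \<gamma> \<le> Q x0"
      using x0(2)[OF x1(1)] wb(3)[OF x1(1)] wb(3)[OF x0(1)] unfolding Q_def \<gamma>_def by argo
    have "x0 \<in> V" using x0(1) x2(3) Q0 gam by (force simp: fr)
    have "r \<le> norm (x0 - z)" using r(2)[OF x0(1)] Q0 gam by fastforce
    then obtain m T C where T: "linear T" "\<And>h k. T h \<bullet> k = h \<bullet> T k"
      and wx: "\<And>h. norm h \<le> 1 \<Longrightarrow> w (x0 - z) + m \<bullet> h \<le> w (x0 - z + h) \<and>
            w (x0 - z + h) \<le> w (x0 - z) + m \<bullet> h + T h \<bullet> h / 2 + C * norm h ^ 3"
      and mT: "\<And>q. q \<in> subdifferential (dual_norm \<phi>) m \<Longrightarrow> 1/2 \<le> q \<bullet> m \<and> T q \<bullet> q \<le> \<kappa>"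
      using wT by metis
    define g where "g = l - 2 * k * w (x0 - z)"
    have g: "0 < g" "g \<le> l + 2 * k"
    proof -
      have "k * w (x0 - z) \<le> k * (\<Phi> + 1)" using wb(2)[OF x0(1)] k by (intro mult_left_mono) auto
      then show "0 < g" using k2 l by (simp add: g_def)
      have "k * (-1) \<le> k * w (x0 - z)" using wb(1)[OF x0(1)] k by (intro mult_left_mono) auto
      then show "g \<le> l + 2 * k" by (simp add: g_def)
    qed
    define S where "S h = g *\<^sub>R T h - (2 * k * (m \<bullet> h)) *\<^sub>R m + \<nu> *\<^sub>R h" for h
    have S: "linear S"
      by (rule linearI) (auto simp: S_def linear_add[OF T(1)] linear_cmul[OF T(1)] inner_add_right algebra_simps)
    have Ssym: "S v \<bullet> y = v \<bullet> S y" for v y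
      by (simp add: S_def inner_add_left inner_diff_left inner_add_right inner_diff_right T(2) inner_commute[of m])
    have Sq: "S h \<bullet> h = g * (T h \<bullet> h) - 2 * k * (m \<bullet> h) ^ 2 + \<nu> * (h \<bullet> h)" for h
      by (simp add: S_def inner_add_left inner_diff_left power2_eq_square)
    obtain d where d: "d > 0" "\<And>h. norm h < d \<Longrightarrow> 
       (l * w (x0 - z + h) - k * w (x0 - z + h) ^ 2) - (l * w (x0 - z) - k * w (x0 - z) ^ 2)
       \<le> g * (m \<bullet> h) + (S h \<bullet> h) / 2"
      using concave_barrier_quadratic_bound[of T k l w "x0 - z" \<nu> m C, OF T(1) k _ nu(1) wx] g(1)
      unfolding Sq unfolding g_def by (metis less_imp_le)
    have "\<forall>\<^sub>F y in nhds x0. y \<in> V \<and> dist y x0 < d"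
      using eventually_nhds_in_open[OF V(1) \<open>x0 \<in> V\<close>] eventually_nhds_in_open[of "ball x0 d" x0] d(1)
      by (auto simp: dist_commute elim: eventually_elim2)
    then have "\<forall>\<^sub>F y in nhds x0. u y \<le> quadratic (u x0) (g *\<^sub>R m) S x0 y"
    proof eventually_elim
      case (elim y)
      have "y \<in> closure V" using elim closure_subset by blast
      then have "u y - u x0 \<le> B y - B x0" using x0(2) by fastforce
      also have "\<dots> \<le> g * (m \<bullet> (y - x0)) + (S (y - x0) \<bullet> (y - x0)) / 2"
        using d(2)[of "y - x0"] elim by (simp add: B_def dist_norm algebra_simps)
      finally show ?case by (simp add: quadratic_def)
    qed
    then obtain q where q: "q \<in> subdifferential (dual_norm \<phi>) (g *\<^sub>R m)" "0 \<le> S q \<bullet> q"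
      using sub S Ssym \<open>x0 \<in> V\<close> cl(3) closure_subset unfolding quadratic_subsolution_def by blast
    then have q': "q \<in> subdifferential (dual_norm \<phi>) m"
      using subdifferential_dual_norm_scale[OF f g(1)] by simp
    have "g * (T q \<bullet> q) \<le> k / 8"
    proof -
      have "g * (T q \<bullet> q) \<le> g * \<kappa>" using mT[OF q'] g(1) by (intro mult_left_mono) auto
      also have "\<dots> \<le> (l + 2 * k) * \<kappa>" using g(2) kap(1) by (intro mult_right_mono) auto
      finally show ?thesis using kap(4) by linarith
    qed
    moreover have "k / 2 \<le> 2 * k * (m \<bullet> q) ^ 2"
    proof -
      have "(1/2) ^ 2 \<le> (m \<bullet> q) ^ 2" using mT[OF q'] by (intro power_mono) (auto simp: inner_commute)
      then have "2 * k * (1/2) ^ 2 \<le> 2 * k * (m \<bullet> q) ^ 2" using k by (intro mult_left_mono) auto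
      then show ?thesis by (simp add: power2_eq_square)
    qed
    moreover have "\<nu> * (q \<bullet> q) \<le> k / 8"
    proof -
      have "\<nu> * norm q ^ 2 \<le> \<nu> * b ^ 2" using b(2)[OF q'] nu(1) by (intro mult_left_mono power_mono) auto
      then show ?thesis using nu(2) by (simp add: power2_norm_eq_inner)
    qed
    ultimately show False using q(2) k unfolding Sq by linarith
  qed
  ultimately show ?thesis using x1(2) x2(2) unfolding Q_def by linarith
qed

theorem theorem2:
  fixes \<phi> :: "real ^ 'n \<Rightarrow> real" and U :: "(real ^ 'n) set"
  assumes "finsler_norm \<phi>" and "open U"
  shows "Sub \<phi> U \<subseteq> CCA \<phi> U \<and> Super \<phi> U \<subseteq> CCB \<phi> U"
proof (intro conjI subsetI)
  fix u assume u: "u \<in> Sub \<phi> U"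
  then have "u \<in> USC U" by (simp add: Sub_def)
  then show "u \<in> CCA \<phi> U"
    using quadratic_subsolution_cone_max[OF assms(1) _ Sub_quadratic[OF assms(1) u]]
    by (simp add: CCA_def)
next
  fix v assume v: "v \<in> Super \<phi> U"
  then have lsc: "v \<in> LSC U" by (simp add: Super_def)
  have "(INF x\<in>closure V. v x + l * \<phi> (z - x)) = (INF x\<in>frontier V. v x + l * \<phi> (z - x))"
    if V: "open V" "V \<noteq> {}" "compactly_inside V U" "z \<notin> V" "l > 0" for V z l
  proof -
    have INF_SUP: "(INF x\<in>K. v x + l * \<phi> (z - x)) = - (SUP x\<in>K. - v x - l * \<phi> (- (x - z)))" for K
      by (simp add: Inf_real_def image_image)
    show ?thesis
      unfolding INF_SUP
      using quadratic_subsolution_cone_max[OF finsler_norm_reflect[OF assms(1)] LSC_uminus[OF lsc]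
          Super_quadratic[OF assms(1) v] V]
      by simp
  qed
  then show "v \<in> CCB \<phi> U" using lsc by (simp add: CCB_def)
qed

end
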